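(* Let $\{Z_n(dy)\}_{n\ge 0}$ be the LF-process on $(E,\mathcal E)$ defined by a triplet $\{K(x,dy),\gamma(dy),m\}$, so that for every $x\in E$ $$\mathrm{E}_x \exp\Big\{\int Z_1(dy)\ln h(y)\Big\}=1-K(x,E)+\frac{\int h(y)K(x,dy)}{1+m-m\int h(y)\gamma(dy)}.$$ Then for each $n\ge 2$ and every $x\in E$, $$\mathrm{E}_x \exp\Big\{\int Z_n(dy)\ln h(y)\Big\}=1-K_n(x,E)+\frac{\int h(y)K_n(x,dy)}{1+m_n-m_n\int h(y)\gamma_n(dy)},$$ where the triplet $\{K_n(x,dy),\gamma_n(dy),m_n\}$ (a sub-stochastic kernel, a probability measure and a number in $(0,\infty)$) is uniquely specified by the relations $$m_n=m\sum_{k=0}^{n-1}\int M^k(x,E)\,\gamma(dx),$$ $$\gamma_n(A)=m_n^{-1}\,m\sum_{k=0}^{n-1}\int M^k(x,A)\,\gamma(dx),\qquad A\in\mathcal E,$$ $$K_n(x,A)=M^n(x,A)-\frac{m_n}{1+m_n}M^n(x,E)\,\gamma_n(A),\qquad x\in E,\ A\in\mathcal E.$$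
   Context: $(E,\mathcal E)$ is a measurable space (of types); all integrals are over $E$. A triplet $\{K(x,dy),\gamma(dy),m\}$ consists of a sub-stochastic kernel $K$ on $(E,\mathcal E)$ (so $K(x,E)\le 1$), a probability measure $\gamma$ on $(E,\mathcal E)$, and a number $m\in(0,\infty)$. LF-process: the discrete-time multi-type Bienaymé-Galton-Watson process with type space $E$, in which particles of the same generation reproduce independently of each other, each according to a law determined by its type, as follows. A particle of type $x$ has no offspring with probability $1-K(x,E)$; with probability $K(x,E)$ it has $k\ge1$ offspring, where, given that there is at least one offspring, $k$ has probability $m^{k-1}/(1+m)^k$, $k\ge 1$. Given that there are $k\ge1$ offspring, their types are independent, one of them (the marked one) having type distribution $\kappa_x(dy)=K(x,dy)/K(x,E)$ and the remaining $k-1$ having type distribution $\gamma$. $Z_n(A)$ denotes the number of $n$-th generation particles with types in $A\in\mathcal E$. $\mathrm{P}_x,\mathrm{E}_x$ denote probability and expectation given that the process starts from a single particle of type $x$. The expectation kernel is $M(x,A)=\mathrm{E}_xZ_1(A)=K(x,A)+K(x,E)\,m\,\gamma(A)$, with powers $M^0(x,A)=1_{\{x\in A\}}$, $M^n(x,A)=\int M^{n-1}(y,A)M(x,dy)$, $n\ge 1$. Generating functionals are taken over measurable $h:E\to[0,1]$; $\exp\{\int Z(dy)\ln h(y)\}$ denotes the product of the values of $h$ over the points of the finite integer-valued measure $Z$ counted with multiplicity (equal to $1$ if $Z=0$). *)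

theory Defs
  imports "HOL-Probability.Probability"
begin

text \<open>A generation is recorded as the finite list of the types of its particles; the order of the
  list plays no role. The \<open>\<sigma>\<close>-algebra is generated by the rectangles
  \<open>A\<^sub>1 \<times> \<dots> \<times> A\<^sub>k\<close> of all lengths \<open>k\<close>.\<close>

definition config_space :: "'a measure \<Rightarrow> 'a list measure" where
  "config_space E = sigma (lists (space E)) (listset ` lists (sets E))"

definition num_in :: "'a set \<Rightarrow> 'a list \<Rightarrow> nat" where
  "num_in A zs = length (filter (\<lambda>z. z \<in> A) zs)"

text \<open>Joint law, on \<open>config_space N\<close>, of independent random elements of \<open>N\<close> with the given
  marginal laws.\<close>

primrec indep_list :: "'a measure \<Rightarrow> 'a measure list \<Rightarrow> 'a list measure" where
  "indep_list N [] = return (config_space N) []"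
| "indep_list N (\<mu> # \<mu>s) =
     \<mu> \<bind> (\<lambda>y. indep_list N \<mu>s \<bind> (\<lambda>ys. return (config_space N) (y # ys)))"

definition LF_triplet :: "'a measure \<Rightarrow> ('a \<Rightarrow> 'a measure) \<Rightarrow> 'a measure \<Rightarrow> real \<Rightarrow> bool" where
  "LF_triplet E K \<gamma> m \<longleftrightarrow>
     K \<in> E \<rightarrow>\<^sub>M subprob_algebra E \<and> prob_space \<gamma> \<and> sets \<gamma> = sets E \<and> 0 < m"

definition LF_size :: "('a \<Rightarrow> 'a measure) \<Rightarrow> real \<Rightarrow> 'a \<Rightarrow> nat measure" where
  "LF_size K m x = density (count_space UNIV) (\<lambda>k. ennreal
     (if k = 0 then 1 - measure (K x) (space (K x))
      else measure (K x) (space (K x)) * (m ^ (k - 1) / (1 + m) ^ k)))"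

text \<open>The normalised measure \<open>K x / K x E\<close>; it is the null measure if \<open>K x E = 0\<close>, in which case
  it is only used with weight zero below.\<close>

definition LF_marked :: "('a \<Rightarrow> 'a measure) \<Rightarrow> 'a \<Rightarrow> 'a measure" where
  "LF_marked K x = scale_measure (1 / emeasure (K x) (space (K x))) (K x)"

text \<open>Law of the list of children of a particle of type \<open>x\<close>, the marked child coming first.\<close>

definition LF_offspring ::
  "'a measure \<Rightarrow> ('a \<Rightarrow> 'a measure) \<Rightarrow> 'a measure \<Rightarrow> real \<Rightarrow> 'a \<Rightarrow> 'a list measure" where
  "LF_offspring E K \<gamma> m x = LF_size K m x \<bind>
     (\<lambda>k. indep_list E (if k = 0 then [] else LF_marked K x # replicate (k - 1) \<gamma>))"

text \<open>Law of the next generation when the current one is \<open>xs\<close>: the lists of children of the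
  particles are independent, and are concatenated.\<close>

definition LF_step ::
  "'a measure \<Rightarrow> ('a \<Rightarrow> 'a measure) \<Rightarrow> 'a measure \<Rightarrow> real \<Rightarrow> 'a list \<Rightarrow> 'a list measure" where
  "LF_step E K \<gamma> m xs =
     distr (indep_list (config_space E) (map (LF_offspring E K \<gamma> m) xs)) (config_space E) concat"

text \<open>\<open>Z\<close> is a realisation, on the probability space \<open>\<Omega>\<close>, of the process started from one
  particle of type \<open>x\<close>. The last clause says that the conditional law of \<open>Z (Suc n)\<close> given
  \<open>Z 0, \<dots>, Z n\<close> is \<open>LF_step E K \<gamma> m (Z n)\<close>.\<close>

definition LF_process ::
  "'a measure \<Rightarrow> ('a \<Rightarrow> 'a measure) \<Rightarrow> 'a measure \<Rightarrow> real \<Rightarrow> 'a \<Rightarrow>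
   'w measure \<Rightarrow> (nat \<Rightarrow> 'w \<Rightarrow> 'a list) \<Rightarrow> bool" where
  "LF_process E K \<gamma> m x \<Omega> Z \<longleftrightarrow>
     prob_space \<Omega> \<and> (\<forall>n. Z n \<in> \<Omega> \<rightarrow>\<^sub>M config_space E) \<and>
     distr \<Omega> (config_space E) (Z 0) = return (config_space E) [x] \<and>
     (\<forall>n. \<forall>H \<in> sets (PiM {..n} (\<lambda>_. config_space E)). \<forall>B \<in> sets (config_space E).
        emeasure \<Omega> {\<omega> \<in> space \<Omega>. (\<lambda>i\<in>{..n}. Z i \<omega>) \<in> H \<and> Z (Suc n) \<omega> \<in> B} =
        (\<integral>\<^sup>+\<omega>. indicator H (\<lambda>i\<in>{..n}. Z i \<omega>) * emeasure (LF_step E K \<gamma> m (Z n \<omega>)) B \<partial>\<Omega>))"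

text \<open>From a single particle of type \<open>x\<close>, the first generation has law \<open>LF_offspring E K \<gamma> m x\<close>.\<close>

definition LF_mean ::
  "'a measure \<Rightarrow> ('a \<Rightarrow> 'a measure) \<Rightarrow> 'a measure \<Rightarrow> real \<Rightarrow> 'a \<Rightarrow> 'a measure" where
  "LF_mean E K \<gamma> m x = measure_of (space E) (sets E)
     (\<lambda>A. \<integral>\<^sup>+zs. of_nat (num_in A zs) \<partial>LF_offspring E K \<gamma> m x)"

text \<open>Real-valued, with Bochner integrals: the total mass of \<open>LF_mean E K \<gamma> m x\<close> is at most
  \<open>1 + m\<close>, so all integrands are bounded and integrable.\<close>

primrec kernel_power :: "('a \<Rightarrow> 'a measure) \<Rightarrow> nat \<Rightarrow> 'a \<Rightarrow> 'a set \<Rightarrow> real" where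
  "kernel_power M 0 x A = indicator A x"
| "kernel_power M (Suc n) x A = (\<integral>y. kernel_power M n y A \<partial>M x)"

text \<open>Right-hand side of the linear-fractional generating functional at \<open>h\<close>.\<close>

definition LF_gf :: "('a \<Rightarrow> 'a measure) \<Rightarrow> 'a measure \<Rightarrow> real \<Rightarrow> ('a \<Rightarrow> real) \<Rightarrow> 'a \<Rightarrow> real" where
  "LF_gf K \<gamma> m h x =
     1 - measure (K x) (space (K x)) + (\<integral>y. h y \<partial>K x) / (1 + m - m * (\<integral>y. h y \<partial>\<gamma>))"

definition LF_iterate_relations ::
  "'a measure \<Rightarrow> ('a \<Rightarrow> 'a measure) \<Rightarrow> 'a measure \<Rightarrow> real \<Rightarrow> nat \<Rightarrow>
   ('a \<Rightarrow> 'a measure) \<Rightarrow> 'a measure \<Rightarrow> real \<Rightarrow> bool" where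
  "LF_iterate_relations E K \<gamma> m n Kn \<gamma>n mn \<longleftrightarrow>
     (let M = kernel_power (LF_mean E K \<gamma> m) in
      mn = m * (\<Sum>k<n. \<integral>x. M k x (space E) \<partial>\<gamma>) \<and>
      (\<forall>A \<in> sets E. measure \<gamma>n A = inverse mn * m * (\<Sum>k<n. \<integral>x. M k x A \<partial>\<gamma>)) \<and>
      (\<forall>x \<in> space E. \<forall>A \<in> sets E.
         measure (Kn x) A = M n x A - mn / (1 + mn) * M n x (space E) * measure \<gamma>n A))"


lemma listset_subset_lists:
  assumes "As \<in> lists (sets E)" shows "listset As \<subseteq> lists (space E)"
  using assms
proof (induction As)
  case (Cons A As)
  with sets.sets_into_space[of A E] show ?case
    by (fastforce simp: set_Cons_def subset_iff)
qed simp

lemma listset_sets_Pow: "listset ` lists (sets E) \<subseteq> Pow (lists (space E))"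
  using listset_subset_lists by blast

lemma space_config_space: "space (config_space E) = lists (space E)"
  unfolding config_space_def by (rule space_measure_of_conv)

lemma sets_config_space:
  "sets (config_space E) = sigma_sets (lists (space E)) (listset ` lists (sets E))"
  unfolding config_space_def by (rule sets_measure_of) (rule listset_sets_Pow)

lemma listset_in_config_space: "As \<in> lists (sets E) \<Longrightarrow> listset As \<in> sets (config_space E)"
  unfolding sets_config_space by (rule sigma_sets.Basic) auto

lemma Nil_in_config_space [measurable, simp, intro]: "{[]} \<in> sets (config_space E)"
  using listset_in_config_space[of "[]"] by simp

lemma Nil_in_space_config_space [measurable, simp, intro]: "[] \<in> space (config_space E)"
  by (auto simp: space_config_space)

lemma listset_replicate: "listset (replicate k A) = {xs \<in> lists A. length xs = k}"
  by (induction k) (auto simp: set_Cons_def length_Suc_conv)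

lemma Cons_in_config_space:
  assumes X: "X \<in> sets (E \<Otimes>\<^sub>M config_space E)"
  shows "{y # ys | y ys. (y, ys) \<in> X} \<in> sets (config_space E)"
proof -
  let ?R = "\<lambda>k. listset (replicate k (space E))"
  have "sets (E \<Otimes>\<^sub>M config_space E) =
    sets (sigma (space E \<times> space (config_space E))
      {A \<times> B | A B. A \<in> sets E \<and> B \<in> listset ` lists (sets E)})"
  proof (rule sets_pair_eq)
    show "sets E \<subseteq> Pow (space E)" "sets E = sigma_sets (space E) (sets E)"
      by (auto simp: sets.sigma_sets_eq sets.space_closed)
    show "countable {space E}" "{space E} \<subseteq> sets E" "\<Union>{space E} = space E"
      by auto
    show "listset ` lists (sets E) \<subseteq> Pow (space (config_space E))"
      using listset_sets_Pow[of E] by (simp add: space_config_space)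
    show "sets (config_space E) = sigma_sets (space (config_space E)) (listset ` lists (sets E))"
      by (simp add: sets_config_space space_config_space)
    show "countable (range ?R)" by (intro countable_image countableI_type)
    show "range ?R \<subseteq> listset ` lists (sets E)" by auto
    show "\<Union>(range ?R) = space (config_space E)"
      unfolding listset_replicate space_config_space by auto
  qed
  also have "\<dots> = sigma_sets (space E \<times> lists (space E))
      {A \<times> B | A B. A \<in> sets E \<and> B \<in> listset ` lists (sets E)}"
  proof (subst sets_measure_of)
    show "{A \<times> B |A B. A \<in> sets E \<and> B \<in> listset ` lists (sets E)}
        \<subseteq> Pow (space E \<times> space (config_space E))"
      using listset_sets_Pow[of E] sets.space_closed[of E]
      unfolding space_config_space by blast
  qed (simp add: space_config_space)
  finally have "X \<in> sigma_sets (space E \<times> lists (space E))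
      {A \<times> B | A B. A \<in> sets E \<and> B \<in> listset ` lists (sets E)}"
    using X by blast
  then show ?thesis
  proof induction
    case (Basic X)
    then obtain A As where X: "X = A \<times> listset As" and *: "A \<in> sets E" "As \<in> lists (sets E)"
      by auto
    have "{y # ys | y ys. (y, ys) \<in> X} = listset (A # As)"
      by (auto simp: X set_Cons_def)
    with * show ?case
      using listset_in_config_space[of "A # As" E] by simp
  next
    case Empty show ?case by auto
  next
    case (Compl X)
    have "{y # ys | y ys. (y, ys) \<in> space E \<times> lists (space E) - X} =
      (space (config_space E) - {y # ys | y ys. (y, ys) \<in> X}) - {[]}"
      by (auto simp: space_config_space neq_Nil_conv)
    also have "\<dots> \<in> sets (config_space E)"
      by (intro sets.Diff Compl) auto
    finally show ?case .
  next
    case (Union I)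
    have *: "{y # ys | y ys. (y, ys) \<in> \<Union>(I ` UNIV)} = (\<Union>i. {y # ys | y ys. (y, ys) \<in> I i})"
      by auto
    show ?case unfolding * using Union(2) by (intro sets.countable_UN) auto
  qed
qed

lemma measurable_tl_config [measurable]: "tl \<in> config_space E \<rightarrow>\<^sub>M config_space E"
proof (rule measurableI)
  show "xs \<in> space (config_space E) \<Longrightarrow> tl xs \<in> space (config_space E)" for xs
    by (cases xs) (auto simp: space_config_space)
  fix A assume A: "A \<in> sets (config_space E)"
  from sets.sets_into_space[OF this]
  have *: "tl -` A \<inter> space (config_space E) =
    (if [] \<in> A then {[]} else {}) \<union> {y # ys | y ys. (y, ys) \<in> space E \<times> A}"
    by (intro set_eqI, rename_tac xs, case_tac xs) (auto simp: space_config_space)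
  show "tl -` A \<inter> space (config_space E) \<in> sets (config_space E)"
    unfolding * using A by (intro sets.Un Cons_in_config_space pair_measureI) auto
qed

lemma measurable_hd_config: "hd \<in> restrict_space (config_space E) (- {[]}) \<rightarrow>\<^sub>M E"
proof (rule measurableI)
  show "xs \<in> space (restrict_space (config_space E) (- {[]})) \<Longrightarrow> hd xs \<in> space E" for xs
    by (cases xs) (auto simp: space_restrict_space space_config_space)
  fix A assume A: "A \<in> sets E"
  from sets.sets_into_space[OF this]
  have "hd -` A \<inter> space (restrict_space (config_space E) (- {[]})) =
    {y # ys | y ys. (y, ys) \<in> A \<times> space (config_space E)}"
    by (intro set_eqI, rename_tac xs, case_tac xs) (auto simp: space_config_space space_restrict_space)
  also have "\<dots> \<in> sets (config_space E)"
    using A by (intro Cons_in_config_space pair_measureI) auto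
  finally show "hd -` A \<inter> space (restrict_space (config_space E) (- {[]})) \<in>
      sets (restrict_space (config_space E) (- {[]}))"
    by (auto simp: sets_restrict_space_iff space_restrict_space)
qed

lemma measurable_Cons_config' : "(\<lambda>(y, ys). y # ys) \<in> E \<Otimes>\<^sub>M config_space E \<rightarrow>\<^sub>M config_space E"
proof (rule measurable_sigma_sets)
  show "sets (config_space E) = sigma_sets (lists (space E)) (listset ` lists (sets E))"
    by (rule sets_config_space)
  show "listset ` lists (sets E) \<subseteq> Pow (lists (space E))"
    by (rule listset_sets_Pow)
  show "(\<lambda>(y, ys). y # ys) \<in> space (E \<Otimes>\<^sub>M config_space E) \<rightarrow> lists (space E)"
    by (auto simp: space_pair_measure space_config_space)
  fix A assume "A \<in> listset ` lists (sets E)"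
  then obtain As where As: "As \<in> lists (sets E)" "A = listset As" by auto
  show "(\<lambda>(y, ys). y # ys) -` A \<inter> space (E \<Otimes>\<^sub>M config_space E)
      \<in> sets (E \<Otimes>\<^sub>M config_space E)"
  proof (cases As)
    case Nil with As show ?thesis by (auto simp: vimage_def case_prod_unfold)
  next
    case (Cons B Bs)
    then have "(\<lambda>(y, ys). y # ys) -` A \<inter> space (E \<Otimes>\<^sub>M config_space E) = B \<times> listset Bs"
      using As listset_subset_lists[of Bs E]
      by (auto simp: space_pair_measure space_config_space set_Cons_def
               dest: sets.sets_into_space[of _ E])
    then show ?thesis
      using As Cons by (auto intro!: pair_measureI listset_in_config_space)
  qed
qed

lemma measurable_Cons_config [measurable (raw)]:
  assumes [measurable]: "f \<in> B \<rightarrow>\<^sub>M E" "g \<in> B \<rightarrow>\<^sub>M config_space E"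
  shows "(\<lambda>b. f b # g b) \<in> B \<rightarrow>\<^sub>M config_space E"
proof -
  have "(\<lambda>b. f b # g b) = (\<lambda>(y, ys). y # ys) \<circ> (\<lambda>b. (f b, g b))" by auto
  then show ?thesis using measurable_Cons_config' by (auto intro!: measurable_comp)
qed

lemma measurable_rec_list_config:
  assumes t: "t \<in> B \<rightarrow>\<^sub>M config_space E"
  assumes l: "l \<in> B \<rightarrow>\<^sub>M A"
  assumes n: "(\<lambda>(b, y, ys, r). n b y ys r) \<in> B \<Otimes>\<^sub>M E \<Otimes>\<^sub>M config_space E \<Otimes>\<^sub>M A \<rightarrow>\<^sub>M A"
    (is "?N \<in> _ \<rightarrow>\<^sub>M _")
  shows "(\<lambda>b. rec_list (l b) (n b) (t b)) \<in> B \<rightarrow>\<^sub>M A"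
proof (rule measurable_piecewise_restrict)
  let ?C = "\<lambda>t k. t -` listset (replicate k (space E))"
  show "countable (range (?C t))" by (intro countable_image countableI_type)
  show "space B \<subseteq> (\<Union>k. ?C t k)"
    using t[THEN measurable_space] by (auto simp: listset_replicate space_config_space)
  fix \<Omega> assume "\<Omega> \<in> range (?C t)"
  then obtain k where \<Omega>: "\<Omega> = ?C t k" by auto
  then show "\<Omega> \<inter> space B \<in> sets B"
    by (auto intro!: measurable_sets[OF t] listset_in_config_space)
  show "(\<lambda>b. rec_list (l b) (n b) (t b)) \<in> restrict_space B \<Omega> \<rightarrow>\<^sub>M A"
    unfolding \<Omega> using t
  proof (induction k arbitrary: t)
    case 0
    show ?case
    proof (rule measurable_cong[THEN iffD2])
      show "rec_list (l \<omega>) (n \<omega>) (t \<omega>) = l \<omega>" if "\<omega> \<in> space (restrict_space B (?C t 0))" for \<omega>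
        using that by (auto simp: space_restrict_space)
      show "l \<in> restrict_space B (?C t 0) \<rightarrow>\<^sub>M A"
        using l by (rule measurable_restrict_space1)
    qed
  next
    case (Suc k)
    let ?F = "\<lambda>b. ?N (b, hd (t b), tl (t b), rec_list (l b) (n b) (tl (t b)))"
    show ?case
    proof (rule measurable_cong[THEN iffD2])
      show "rec_list (l \<omega>) (n \<omega>) (t \<omega>) = ?F \<omega>" if "\<omega> \<in> space (restrict_space B (?C t (Suc k)))" for \<omega>
        using that by (auto simp: space_restrict_space set_Cons_def)
      show "?F \<in> restrict_space B (?C t (Suc k)) \<rightarrow>\<^sub>M A"
        apply (intro measurable_compose[OF _ n] measurable_Pair[rotated])
        subgoal
          apply (rule measurable_restrict_mono[OF Suc(1)])
           apply (rule measurable_compose[OF Suc(2) measurable_tl_config])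
          by (auto simp: set_Cons_def)
        subgoal
          by (rule measurable_restrict_space1)
             (rule measurable_compose[OF Suc(2) measurable_tl_config])
        subgoal
          apply (rule measurable_compose[OF _ measurable_hd_config])
          apply (rule measurable_restrict_space3[OF Suc(2)])
          by (auto simp: set_Cons_def)
        by (rule measurable_restrict_space1) auto
    qed
  qed
qed

lemma measurable_append_config [measurable (raw)]:
  fixes E :: "'b measure"
  assumes [measurable]: "f \<in> B \<rightarrow>\<^sub>M config_space E" "g \<in> B \<rightarrow>\<^sub>M config_space E"
  shows "(\<lambda>b. f b @ g b) \<in> B \<rightarrow>\<^sub>M config_space E"
proof -
  have "xs @ ys = rec_list ys (\<lambda>y ys r. y # r) xs" for xs ys :: "'b list"
    by (induction xs) auto
  then show ?thesis
    by (auto intro!: measurable_rec_list_config[where n="\<lambda>b y ys r. y # r" and E=E])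
qed

lemma measurable_concat_config [measurable]:
  "concat \<in> config_space (config_space E) \<rightarrow>\<^sub>M config_space E"
proof -
  have "concat xss = rec_list [] (\<lambda>y ys r. y @ r) xss" for xss :: "'a list list"
    by (induction xss) auto
  then have "concat = (\<lambda>xss :: 'a list list. rec_list [] (\<lambda>y ys r. y @ r) xss)" by auto
  then show ?thesis
    using measurable_rec_list_config[where t="\<lambda>x. x" and B="config_space (config_space E)" and l="\<lambda>_. []"
       and n="\<lambda>b y ys r. y @ r" and A="config_space E" and E="config_space E"] by simp
qed

lemma measurable_indep_list_map:
  assumes f: "f \<in> E \<rightarrow>\<^sub>M prob_algebra N"
  shows "(\<lambda>xs. indep_list N (map f xs)) \<in> config_space E \<rightarrow>\<^sub>M prob_algebra (config_space N)"
proof -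
  note [measurable] = f
  let ?n = "\<lambda>b y ys r. f y \<bind> (\<lambda>z. r \<bind> (\<lambda>zs. return (config_space N) (z # zs)))"
  have "indep_list N (map f xs) = rec_list (return (config_space N) []) (?n ()) xs" for xs
    by (induction xs) auto
  moreover have "(\<lambda>xs. rec_list (return (config_space N) []) (?n xs) xs)
      \<in> config_space E \<rightarrow>\<^sub>M prob_algebra (config_space N)"
  proof (rule measurable_rec_list_config)
    show "(\<lambda>(b, y, ys, r). f y \<bind> (\<lambda>z. r \<bind> (\<lambda>zs. return (config_space N) (z # zs))))
      \<in> config_space E \<Otimes>\<^sub>M E \<Otimes>\<^sub>M config_space E \<Otimes>\<^sub>M prob_algebra (config_space N) \<rightarrow>\<^sub>M
        prob_algebra (config_space N)"
      by measurable
  qed (auto simp: space_prob_algebra prob_space_return)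
  ultimately show ?thesis by simp
qed


lemma LF_tripletD:
  assumes "LF_triplet E K \<gamma> m"
  shows "K \<in> E \<rightarrow>\<^sub>M subprob_algebra E" "prob_space \<gamma>" "sets \<gamma> = sets E" "space \<gamma> = space E" "0 < m"
    "x \<in> space E \<Longrightarrow> sets (K x) = sets E" "x \<in> space E \<Longrightarrow> space (K x) = space E"
    "x \<in> space E \<Longrightarrow> subprob_space (K x)"
proof -
  show *: "K \<in> E \<rightarrow>\<^sub>M subprob_algebra E" "prob_space \<gamma>" "sets \<gamma> = sets E" "0 < m"
    using assms by (auto simp: LF_triplet_def)
  show "space \<gamma> = space E" using *(3) by (rule sets_eq_imp_space_eq)
  show "x \<in> space E \<Longrightarrow> sets (K x) = sets E" "x \<in> space E \<Longrightarrow> space (K x) = space E"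
    using *(1) by (auto dest: subprob_measurableD)
  show "x \<in> space E \<Longrightarrow> subprob_space (K x)"
    using *(1) by (rule subprob_space_kernel)
qed

lemma LF_size_sums:
  fixes m p :: real
  assumes "0 < m"
  shows "(\<lambda>k. if k = 0 then 1 - p else p * (m ^ (k - 1) / (1 + m) ^ k)) sums 1"
proof -
  have "(\<lambda>k. (m / (1 + m)) ^ k) sums (1 / (1 - m / (1 + m)))"
    using assms by (intro geometric_sums) auto
  also have "1 / (1 - m / (1 + m)) = 1 + m"
    using assms by (simp add: field_simps)
  finally have "(\<lambda>k. p / (1 + m) * (m / (1 + m)) ^ k) sums (p / (1 + m) * (1 + m))"
    by (rule sums_mult)
  also have "p / (1 + m) * (1 + m) = p" using assms by simp
  also have "(\<lambda>k. p / (1 + m) * (m / (1 + m)) ^ k) = (\<lambda>k. p * (m ^ k / (1 + m) ^ Suc k))"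
    by (simp add: power_divide)
  finally have "(\<lambda>k. (\<lambda>k. if k = 0 then 1 - p else p * (m ^ (k - 1) / (1 + m) ^ k)) (Suc k)) sums p"
    by simp
  from sums_Suc[OF this] show ?thesis by simp
qed

lemma measurable_LF_size:
  assumes T: "LF_triplet E K \<gamma> m"
  shows "LF_size K m \<in> E \<rightarrow>\<^sub>M prob_algebra (count_space UNIV)"
proof -
  note [measurable] = LF_tripletD(1)[OF T]
  define f where "f x k = (if k = 0 then 1 - measure (K x) (space (K x))
      else measure (K x) (space (K x)) * (m ^ (k - 1) / (1 + m) ^ k))" for x and k :: nat
  have L: "LF_size K m x = density (count_space UNIV) (\<lambda>k. ennreal (f x k))" for x
    by (simp add: LF_size_def f_def)
  have prob: "prob_space (LF_size K m x)" if "x \<in> space E" for x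
  proof
    interpret subprob_space "K x" using that by (rule LF_tripletD[OF T])
    have f: "f x k \<ge> 0" for k
      using LF_tripletD(5)[OF T] subprob_measure_le_1 by (auto simp: f_def)
    have "emeasure (LF_size K m x) (space (LF_size K m x)) = (\<integral>\<^sup>+k. f x k \<partial>count_space UNIV)"
      unfolding L by (simp add: emeasure_density)
    also have "\<dots> = (\<Sum>k. ennreal (f x k))" by (rule nn_integral_count_space_nat)
    also have "\<dots> = 1"
      using LF_size_sums[OF LF_tripletD(5)[OF T], of "measure (K x) (space (K x))"] f
      by (subst suminf_ennreal2) (auto simp: f_def[abs_def] sums_iff)
    finally show "emeasure (LF_size K m x) (space (LF_size K m x)) = 1" .
  qed
  have "(\<lambda>x. measure (K x) (space E)) \<in> borel_measurable E" by measurable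
  then have "(\<lambda>x. measure (K x) (space (K x))) \<in> borel_measurable E"
    by (rule measurable_cong[THEN iffD1, rotated]) (simp add: LF_tripletD(7)[OF T])
  then have [measurable]: "(\<lambda>x. f x k) \<in> borel_measurable E" for k
    unfolding f_def by (cases k) auto
  show ?thesis
  proof (rule measurable_prob_algebraI)
    show "prob_space (LF_size K m x)" if "x \<in> space E" for x using prob that .
    show "LF_size K m \<in> E \<rightarrow>\<^sub>M subprob_algebra (count_space UNIV)"
    proof (rule measurable_subprob_algebra)
      show "subprob_space (LF_size K m x)" if "x \<in> space E" for x
        using prob[OF that] by (rule prob_space_imp_subprob_space)
      show "sets (LF_size K m x) = sets (count_space UNIV)" for x by (simp add: L)
      fix A :: "nat set"
      have "emeasure (LF_size K m x) A = (\<Sum>k. ennreal (f x k) * indicator A k)" for x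
        unfolding L by (simp add: emeasure_density nn_integral_count_space_nat)
      then show "(\<lambda>x. emeasure (LF_size K m x) A) \<in> borel_measurable E" by simp
    qed
  qed
qed

lemma emeasure_LF_marked: "emeasure (LF_marked K x) A = emeasure (K x) A / emeasure (K x) (space (K x))"
  by (simp add: LF_marked_def divide_ennreal_def mult.commute)

lemma measurable_LF_marked:
  assumes T: "LF_triplet E K \<gamma> m"
  shows "LF_marked K \<in> E \<rightarrow>\<^sub>M subprob_algebra E"
proof (rule measurable_subprob_algebra)
  note [measurable] = LF_tripletD(1)[OF T]
  fix x assume x: "x \<in> space E"
  interpret subprob_space "K x" using x by (rule LF_tripletD[OF T])
  show "sets (LF_marked K x) = sets E" using LF_tripletD(6)[OF T x] by (simp add: LF_marked_def)
  show "subprob_space (LF_marked K x)"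
  proof
    show "emeasure (LF_marked K x) (space (LF_marked K x)) \<le> 1"
      unfolding emeasure_LF_marked
      by (cases "emeasure (K x) (space (K x)) = 0")
         (auto simp: LF_marked_def space_scale_measure emeasure_eq_measure divide_ennreal)
    show "space (LF_marked K x) \<noteq> {}"
      using subprob_not_empty by (simp add: LF_marked_def space_scale_measure)
  qed
next
  note [measurable] = LF_tripletD(1)[OF T]
  fix A assume [measurable]: "A \<in> sets E"
  have "(\<lambda>x. emeasure (K x) A * inverse (emeasure (K x) (space E))) \<in> borel_measurable E"
    by measurable
  then show "(\<lambda>x. emeasure (LF_marked K x) A) \<in> borel_measurable E"
    by (rule measurable_cong[THEN iffD1, rotated])
       (simp add: emeasure_LF_marked divide_ennreal_def LF_tripletD(7)[OF T])
qed

lemma prob_space_LF_marked: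
  assumes T: "LF_triplet E K \<gamma> m" and x: "x \<in> space E" and "measure (K x) (space (K x)) \<noteq> 0"
  shows "prob_space (LF_marked K x)"
proof
  interpret subprob_space "K x" using x by (rule LF_tripletD[OF T])
  show "emeasure (LF_marked K x) (space (LF_marked K x)) = 1"
    using assms(3) unfolding emeasure_LF_marked
    by (simp add: LF_marked_def space_scale_measure emeasure_eq_measure ennreal_divide_self measure_nonneg less_le)
qed

lemma indep_list_in_prob_algebra:
  assumes "\<And>\<mu>. \<mu> \<in> set \<mu>s \<Longrightarrow> \<mu> \<in> space (prob_algebra N)"
  shows "indep_list N \<mu>s \<in> space (prob_algebra (config_space N))"
  using assms
proof (induction \<mu>s)
  case (Cons \<mu> \<mu>s)
  let ?P = "prob_algebra (config_space N)"
  have I: "indep_list N \<mu>s \<in> space ?P" by (rule Cons) (auto intro: Cons)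
  have [measurable]: "(\<lambda>_. \<mu>) \<in> count_space {()} \<rightarrow>\<^sub>M prob_algebra N" using Cons by auto
  have [measurable]: "(\<lambda>_. indep_list N \<mu>s) \<in> X \<rightarrow>\<^sub>M ?P" for X using I by auto
  have "(\<lambda>_. \<mu> \<bind> (\<lambda>y. indep_list N \<mu>s \<bind> (\<lambda>ys. return (config_space N) (y # ys))))
    \<in> count_space {()} \<rightarrow>\<^sub>M ?P"
    by measurable
  from measurable_space[OF this, of "()"] show ?case by simp
qed (auto simp: space_prob_algebra prob_space_return)

lemma measurable_LF_offspring:
  assumes T: "LF_triplet E K \<gamma> m"
  shows "LF_offspring E K \<gamma> m \<in> E \<rightarrow>\<^sub>M prob_algebra (config_space E)"
proof -
  note [measurable] = measurable_LF_marked[OF T] measurable_LF_size[OF T]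
    measurable_prob_algebraD[OF measurable_LF_size[OF T]]
  let ?I = "\<lambda>x k. indep_list E (if k = 0 then [] else LF_marked K x # replicate (k - 1) \<gamma>)"
  have \<gamma>: "\<gamma> \<in> space (prob_algebra E)"
    using LF_tripletD[OF T] by (simp add: space_prob_algebra)
  have [measurable]: "(\<lambda>_. indep_list E (replicate k \<gamma>)) \<in> X \<rightarrow>\<^sub>M subprob_algebra (config_space E)"
    for X :: "'b measure" and k
    using indep_list_in_prob_algebra[of "replicate k \<gamma>" E] \<gamma>
    by (intro measurable_prob_algebraD) auto
  have I: "(\<lambda>x. ?I x k) \<in> E \<rightarrow>\<^sub>M subprob_algebra (config_space E)" for k
  proof (cases k)
    case (Suc j)
    have "(\<lambda>x. LF_marked K x \<bind> (\<lambda>y. indep_list E (replicate j \<gamma>) \<bind> (\<lambda>ys. return (config_space E) (y # ys))))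
      \<in> E \<rightarrow>\<^sub>M subprob_algebra (config_space E)" by measurable
    then show ?thesis using Suc by simp
  qed simp
  have I2: "(\<lambda>(x, k). ?I x k) \<in> E \<Otimes>\<^sub>M count_space UNIV \<rightarrow>\<^sub>M subprob_algebra (config_space E)"
    using I by (subst measurable_pair_swap_iff) (auto intro!: measurable_pair_measure_countable1)
  show ?thesis
  proof (rule measurable_prob_algebraI)
    show "LF_offspring E K \<gamma> m \<in> E \<rightarrow>\<^sub>M subprob_algebra (config_space E)"
      unfolding LF_offspring_def[abs_def]
      by (rule measurable_bind'[OF _ I2]) measurable
    fix x assume x: "x \<in> space E"
    let ?S = "LF_size K m x"
    have S: "?S \<in> space (prob_algebra (count_space UNIV))"
      using measurable_space[OF measurable_LF_size[OF T] x] .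
    interpret S: prob_space ?S using S by (simp add: space_prob_algebra)
    show "prob_space (LF_offspring E K \<gamma> m x)"
      unfolding LF_offspring_def
    proof (rule S.prob_space_bind[where S="config_space E"])
      show "AE k in ?S. prob_space (?I x k)"
        unfolding LF_size_def
      proof (subst AE_density, simp, subst AE_count_space, safe)
        fix k :: nat
        assume k: "0 < ennreal (if k = 0 then 1 - measure (K x) (space (K x))
             else measure (K x) (space (K x)) * (m ^ (k - 1) / (1 + m) ^ k))"
        have "LF_marked K x \<in> space (prob_algebra E)" if "k \<noteq> 0"
          using k that prob_space_LF_marked[OF T x]
            zero_less_mult_iff[of "measure (K x) (space (K x))"] measurable_space[OF measurable_LF_marked[OF T] x]
          by (cases "measure (K x) (space (K x)) = 0") (auto simp: space_prob_algebra space_subprob_algebra)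
        then have "?I x k \<in> space (prob_algebra (config_space E))"
          using \<gamma> by (intro indep_list_in_prob_algebra) (auto split: if_splits)
        then show "prob_space (?I x k)" by (simp add: space_prob_algebra)
      qed
      show "?I x \<in> ?S \<rightarrow>\<^sub>M subprob_algebra (config_space E)"
        using measurable_Pair2[OF I2 x] S
        by (subst measurable_cong_sets[where M'="count_space UNIV", OF _ refl])
           (auto simp: space_prob_algebra)
    qed
  qed
qed

lemma measurable_LF_step:
  assumes T: "LF_triplet E K \<gamma> m"
  shows "LF_step E K \<gamma> m \<in> config_space E \<rightarrow>\<^sub>M prob_algebra (config_space E)"
  unfolding LF_step_def[abs_def]
  using measurable_compose[OF measurable_indep_list_map[OF measurable_LF_offspring[OF T]]
      measurable_distr_prob_space[OF measurable_concat_config]] .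

text \<open>Realisations exist for every triplet and every starting type (Ionescu-Tulcea), so
  \<open>LF_process\<close> is never a vacuous hypothesis.\<close>

lemma LF_process_exists:
  fixes E :: "'a measure"
  assumes T: "LF_triplet E K \<gamma> m" and x: "x \<in> space E"
  shows "\<exists>(\<Omega> :: (nat \<Rightarrow> 'a list) measure) Z. LF_process E K \<gamma> m x \<Omega> Z"
proof -
  let ?C = "config_space E"
  define P where "P i \<omega> = (if i = 0 then return ?C [x] else LF_step E K \<gamma> m (\<omega> (i - 1)))"
    for i :: nat and \<omega> :: "nat \<Rightarrow> 'a list"
  have x': "[x] \<in> space ?C" using x by (auto simp: space_config_space)
  have meas: "P i \<in> PiM {0..<i} (\<lambda>_. ?C) \<rightarrow>\<^sub>M prob_algebra ?C" for i
  proof (cases i)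
    case 0 then show ?thesis using x' by (auto simp: P_def[abs_def] space_prob_algebra prob_space_return)
  next
    case (Suc j)
    have "(\<lambda>\<omega>. \<omega> j) \<in> PiM {0..<i} (\<lambda>_. ?C) \<rightarrow>\<^sub>M ?C"
      using Suc by (intro measurable_component_singleton) auto
    from measurable_compose[OF this measurable_LF_step[OF T]] Suc
    show ?thesis by (simp add: P_def[abs_def])
  qed
  interpret IT: Ionescu_Tulcea P "\<lambda>_. ?C"
  proof (rule Ionescu_Tulcea.intro)
    show "P i \<in> PiM {0..<i} (\<lambda>_. ?C) \<rightarrow>\<^sub>M subprob_algebra ?C" for i
      using meas by (rule measurable_prob_algebraD)
    show "prob_space (P i \<omega>)" if "\<omega> \<in> space (PiM {0..<i} (\<lambda>_. ?C))" for i \<omega>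
      using measurable_space[OF meas that] by (simp add: space_prob_algebra)
  qed
  let ?L = "IT.PF.lim"
  have sets_L[measurable_cong]: "sets ?L = sets (PiM UNIV (\<lambda>_. ?C))" by simp
  have space_L: "space ?L = space (PiM UNIV (\<lambda>_. ?C))" using sets_L by (rule sets_eq_imp_space_eq)
  let ?u = "\<lambda>_::nat. undefined :: 'a list"
  have u: "?u \<in> space (PiM {0..<0} (\<lambda>_. ?C))" by (simp add: space_PiM)
  have distr_L: "distr ?L (PiM {0..<n} (\<lambda>_. ?C)) (\<lambda>\<omega>. restrict \<omega> {0..<n}) = IT.C 0 n ?u" for n
  proof -
    have "distr ?L (PiM {0..<n} (\<lambda>_. ?C)) (\<lambda>\<omega>. restrict \<omega> {0..<n}) = IT.CI {0..<n}"
      by (rule IT.distr_lim) simp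
    also have "\<dots> = IT.C 0 n ?u"
    proof (rule measure_eqI)
      show "sets (IT.CI {0..<n}) = sets (IT.C 0 n ?u)"
        using IT.sets_C[OF u, of n] by (simp add: IT.CI_def)
      fix X assume "X \<in> sets (IT.CI {0..<n})"
      then have X: "X \<in> sets (PiM {0..<n} (\<lambda>_. ?C))" by (simp add: IT.CI_def)
      show "emeasure (IT.CI {0..<n}) X = emeasure (IT.C 0 n ?u) X"
        using IT.emeasure_CI[OF order_refl X] sets.sets_into_space[OF X]
        by (simp add: prod_emb_id space_PiM)
    qed
    finally show ?thesis .
  qed
  have R: "(\<lambda>\<omega>. restrict \<omega> {0..<n}) \<in> ?L \<rightarrow>\<^sub>M PiM {0..<n} (\<lambda>_. ?C)" for n
    by (auto intro!: measurable_restrict measurable_component_singleton simp: measurable_cong_sets[OF sets_L refl])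
  have nn_L: "(\<integral>\<^sup>+\<omega>. f (restrict \<omega> {0..<n}) \<partial>?L) = (\<integral>\<^sup>+\<omega>. f \<omega> \<partial>IT.C 0 n ?u)"
    if "f \<in> borel_measurable (PiM {0..<n} (\<lambda>_. ?C))" for f n
    using that R by (simp add: distr_L[symmetric] nn_integral_distr)
  have Z: "(\<lambda>\<omega>. \<omega> n) \<in> ?L \<rightarrow>\<^sub>M ?C" for n
    by (simp add: measurable_cong_sets[OF sets_L refl])
  have "LF_process E K \<gamma> m x ?L (\<lambda>n \<omega>. \<omega> n)"
    unfolding LF_process_def
  proof (intro conjI allI ballI)
    show "prob_space ?L" 
      using IT.prob_space_C[OF u, of 0] unfolding distr_L[symmetric] by (rule prob_space_distrD[OF R])
  next
    show "(\<lambda>\<omega>. \<omega> n) \<in> ?L \<rightarrow>\<^sub>M ?C" for n by (rule Z)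
  next
    show "distr ?L ?C (\<lambda>\<omega>. \<omega> 0) = return ?C [x]"
    proof (rule measure_eqI)
      fix B assume "B \<in> sets (distr ?L ?C (\<lambda>\<omega>. \<omega> 0))"
      then have [measurable]: "B \<in> sets ?C" by simp
      have [measurable]: "(\<lambda>\<omega>. \<omega> 0) \<in> PiM {0..<Suc 0} (\<lambda>_. ?C) \<rightarrow>\<^sub>M ?C"
        by (intro measurable_component_singleton) auto
      have "emeasure (distr ?L ?C (\<lambda>\<omega>. \<omega> 0)) B = (\<integral>\<^sup>+\<omega>. indicator B (restrict \<omega> {0..<Suc 0} 0) \<partial>?L)"
        using nn_integral_distr[OF Z, of "indicator B" 0] by simp
      also have "\<dots> = (\<integral>\<^sup>+\<omega>. indicator B (\<omega> 0) \<partial>IT.C 0 (Suc 0) ?u)"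
        by (rule nn_L) measurable
      also have "\<dots> = (\<integral>\<^sup>+\<omega>. indicator B (\<omega> 0) \<partial>IT.eP 0 ?u)"
        using u IT.measurable_eP[of 0] by (simp add: bind_return)
      also have "\<dots> = emeasure (return ?C [x]) B"
        using u x' by (subst IT.nn_integral_eP) (auto simp: P_def nn_integral_return)
      finally show "emeasure (distr ?L ?C (\<lambda>\<omega>. \<omega> 0)) B = emeasure (return ?C [x]) B" .
    qed simp
  next
    fix n :: nat and H :: "(nat \<Rightarrow> 'a list) set" and B :: "'a list set"
    assume H: "H \<in> sets (PiM {..n} (\<lambda>_. ?C))" and B[measurable]: "B \<in> sets ?C"
    have eq: "{..n} = {0..<Suc n}" by auto
    let ?N = "{0..<Suc n}"
    have H'[measurable]: "H \<in> sets (PiM ?N (\<lambda>_. ?C))" using H by (simp add: eq)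
    have c[measurable]: "(\<lambda>\<omega>. \<omega> i) \<in> PiM {0..<j} (\<lambda>_. ?C) \<rightarrow>\<^sub>M ?C" if "i < j" for i j :: nat
      using that by (intro measurable_component_singleton) auto
    have r[measurable]: "(\<lambda>\<omega>. restrict \<omega> ?N) \<in> PiM {0..<Suc (Suc n)} (\<lambda>_. ?C) \<rightarrow>\<^sub>M PiM ?N (\<lambda>_. ?C)"
      by (intro measurable_restrict_subset) auto
    have st[measurable]: "(\<lambda>xs. emeasure (LF_step E K \<gamma> m xs) B) \<in> borel_measurable ?C"
      using measurable_prob_algebraD[OF measurable_LF_step[OF T]] by measurable
    let ?f = "\<lambda>\<omega>. indicator H (restrict \<omega> ?N) * indicator B (\<omega> (Suc n)) :: ennreal"
    have f: "?f \<in> borel_measurable (PiM {0..<Suc (Suc n)} (\<lambda>_. ?C))"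
      using c[of "Suc n" "Suc (Suc n)"] by measurable
    have ev: "{\<omega> \<in> space ?L. (\<lambda>i\<in>{..n}. \<omega> i) \<in> H \<and> \<omega> (Suc n) \<in> B} \<in> sets ?L"
      unfolding eq using R[of "Suc n"] Z[of "Suc n"] by measurable
    have "emeasure ?L {\<omega> \<in> space ?L. (\<lambda>i\<in>{..n}. \<omega> i) \<in> H \<and> \<omega> (Suc n) \<in> B} =
      (\<integral>\<^sup>+\<omega>. ?f (restrict \<omega> {0..<Suc (Suc n)}) \<partial>?L)"
      unfolding nn_integral_indicator[OF ev, symmetric]
      by (rule nn_integral_cong) (auto split: split_indicator simp: eq Int_absorb1)
    also have "\<dots> = (\<integral>\<^sup>+\<omega>. ?f \<omega> \<partial>IT.C 0 (Suc (Suc n)) ?u)"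
      by (rule nn_L[OF f])
    also have "\<dots> = (\<integral>\<^sup>+\<omega>. \<integral>\<^sup>+\<omega>'. ?f \<omega>' \<partial>IT.eP (Suc n) \<omega> \<partial>IT.C 0 (Suc n) ?u)"
    proof -
      have "IT.eP (Suc n) \<in> IT.C 0 (Suc n) ?u \<rightarrow>\<^sub>M subprob_algebra (PiM {0..<Suc (Suc n)} (\<lambda>_. ?C))"
        using IT.measurable_eP[of "Suc n"] IT.sets_C[OF u, of "Suc n"]
        by (subst measurable_cong_sets[OF _ refl]) auto
      from nn_integral_bind[OF f this] show ?thesis by simp
    qed
    also have "\<dots> = (\<integral>\<^sup>+\<omega>. indicator H \<omega> * emeasure (LF_step E K \<gamma> m (\<omega> n)) B \<partial>IT.C 0 (Suc n) ?u)"
    proof (rule nn_integral_cong)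
      fix \<omega> assume "\<omega> \<in> space (IT.C 0 (Suc n) ?u)"
      then have \<omega>: "\<omega> \<in> space (PiM ?N (\<lambda>_. ?C))" using IT.space_C[OF u, of "Suc n"] by simp
      then have rw: "restrict (fun_upd \<omega> (Suc n) y) ?N = \<omega>" for y
        by (auto simp: space_PiM PiE_def extensional_def fun_eq_iff)
      have "(\<integral>\<^sup>+\<omega>'. ?f \<omega>' \<partial>IT.eP (Suc n) \<omega>) = (\<integral>\<^sup>+y. indicator H \<omega> * indicator B y \<partial>P (Suc n) \<omega>)"
        using IT.nn_integral_eP[OF \<omega> f] by (simp add: rw)
      also have "\<dots> = indicator H \<omega> * emeasure (P (Suc n) \<omega>) B"
        using IT.sets_P[OF \<omega>] by (simp add: nn_integral_cmult_indicator)
      finally show "(\<integral>\<^sup>+\<omega>'. ?f \<omega>' \<partial>IT.eP (Suc n) \<omega>) = indicator H \<omega> * emeasure (LF_step E K \<gamma> m (\<omega> n)) B"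
        by (simp add: P_def)
    qed
    also have "\<dots> = (\<integral>\<^sup>+\<omega>. indicator H (restrict \<omega> ?N) * emeasure (LF_step E K \<gamma> m (restrict \<omega> ?N n)) B \<partial>?L)"
      using c[of n "Suc n"] by (intro nn_L[symmetric]) measurable
    finally show "emeasure ?L {\<omega> \<in> space ?L. (\<lambda>i\<in>{..n}. \<omega> i) \<in> H \<and> \<omega> (Suc n) \<in> B} =
      (\<integral>\<^sup>+\<omega>. indicator H (\<lambda>i\<in>{..n}. \<omega> i) * emeasure (LF_step E K \<gamma> m (\<omega> n)) B \<partial>?L)"
      by (simp add: eq)
  qed
  then show ?thesis by blast
qed

end

theory Submission
  imports Defs
begin

text \<open>Let \<open>\<phi> h\<close> be the one-step linear-fractional functional. Conditioning on generation \<open>n\<close>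
  shows that the generating functional of generation \<open>n + 1\<close> at \<open>h\<close> is that of generation \<open>n\<close>
  at \<open>\<phi> h\<close>, so it is the iterate of \<open>\<phi>\<close>. Linear-fractional functionals are closed under
  composition: for triplets \<open>(K\<^sub>1, \<gamma>\<^sub>1, m\<^sub>1)\<close> and \<open>(K\<^sub>2, \<gamma>\<^sub>2, m\<^sub>2)\<close>, clearing the inner denominator
  yields an explicit triplet \<open>(K, \<gamma>, m)\<close>, built from \<open>K\<^sub>1 K\<^sub>2\<close>, \<open>\<gamma>\<^sub>1 K\<^sub>2\<close> and \<open>\<gamma>\<^sub>2\<close> with nonnegative
  coefficients, whose mean operator is the product of the two mean operators and for which
  \<open>m \<gamma> = m\<^sub>2 \<gamma>\<^sub>2 + m\<^sub>1 \<gamma>\<^sub>1 M\<^sub>2\<close>. Iterating the latter relation gives the sum over \<open>k < n\<close>, and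
  \<open>M\<^sup>n = K\<^sub>n + m\<^sub>n K\<^sub>n(\<cdot>, E) \<gamma>\<^sub>n\<close> is solved for \<open>K\<^sub>n\<close>.\<close>

section \<open>Functionals of the offspring law\<close>

text \<open>A product over a list is a list recursion, the form covered by
  \<open>measurable_rec_list_config\<close>; the counting functional is treated the same
  way.\<close>

lemma borel_measurable_prod_list_config [measurable (raw)]:
  fixes h :: "'a \<Rightarrow> ennreal"
  assumes [measurable]: "h \<in> borel_measurable E"
  shows "(\<lambda>zs. \<Prod>y\<leftarrow>zs. h y) \<in> borel_measurable (config_space E)"
proof -
  have "(\<Prod>y\<leftarrow>zs. h y) = rec_list 1 (\<lambda>y ys r. h y * r) zs" for zs
    by (induction zs) auto
  then show ?thesis
    by (auto intro!: measurable_rec_list_config[where n="\<lambda>b y ys r. h y * r" and E=E])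
qed

lemma borel_measurable_num_in [measurable]:
  assumes [measurable]: "A \<in> sets E"
  shows "(\<lambda>zs. of_nat (num_in A zs) :: ennreal) \<in> borel_measurable (config_space E)"
proof -
  have "(of_nat (num_in A zs) :: ennreal) = rec_list 0 (\<lambda>y ys r. indicator A y + r) zs" for zs
    by (induction zs) (auto simp: num_in_def)
  then show ?thesis
    by (auto intro!: measurable_rec_list_config[where n="\<lambda>b y ys r. indicator A y + r" and E=E])
qed

lemma indep_list_in_subprob_algebra:
  assumes "\<And>\<mu>. \<mu> \<in> set \<mu>s \<Longrightarrow> \<mu> \<in> space (subprob_algebra N)"
  shows "indep_list N \<mu>s \<in> space (subprob_algebra (config_space N))"
  using assms
proof (induction \<mu>s)
  case (Cons \<mu> \<mu>s)
  let ?P = "subprob_algebra (config_space N)"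
  have I: "indep_list N \<mu>s \<in> space ?P" by (rule Cons) (auto intro: Cons)
  have [measurable]: "(\<lambda>_. \<mu>) \<in> count_space {()} \<rightarrow>\<^sub>M subprob_algebra N" using Cons by auto
  have [measurable]: "(\<lambda>_. indep_list N \<mu>s) \<in> X \<rightarrow>\<^sub>M ?P" for X using I by auto
  have "(\<lambda>_. \<mu> \<bind> (\<lambda>y. indep_list N \<mu>s \<bind> (\<lambda>ys. return (config_space N) (y # ys))))
    \<in> count_space {()} \<rightarrow>\<^sub>M ?P"
    by measurable
  from measurable_space[OF this, of "()"] show ?case by simp
qed (auto simp: space_subprob_algebra prob_space_return prob_space_imp_subprob_space)

text \<open>Splits off the first coordinate: the two nested binds become an iterated
  integral.\<close>

lemma nn_integral_indep_list_Cons: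
  assumes \<mu>: "\<mu> \<in> space (subprob_algebra N)"
    and \<mu>s: "\<And>\<mu>. \<mu> \<in> set \<mu>s \<Longrightarrow> \<mu> \<in> space (subprob_algebra N)"
    and f: "f \<in> borel_measurable (config_space N)"
  shows "(\<integral>\<^sup>+zs. f zs \<partial>indep_list N (\<mu> # \<mu>s)) = (\<integral>\<^sup>+y. \<integral>\<^sup>+ys. f (y # ys) \<partial>indep_list N \<mu>s \<partial>\<mu>)"
proof -
  let ?C = "config_space N" and ?I = "indep_list N \<mu>s"
  note [measurable] = f
  have I: "?I \<in> space (subprob_algebra ?C)"
    using \<mu>s by (rule indep_list_in_subprob_algebra)
  have [measurable]: "(\<lambda>_. ?I) \<in> X \<rightarrow>\<^sub>M subprob_algebra ?C" for X using I by auto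
  have sets[measurable_cong]: "sets \<mu> = sets N" "sets ?I = sets ?C"
    using \<mu> I by (auto simp: space_subprob_algebra)
  have "(\<lambda>y. ?I \<bind> (\<lambda>ys. return ?C (y # ys))) \<in> \<mu> \<rightarrow>\<^sub>M subprob_algebra ?C"
    by measurable
  then have "(\<integral>\<^sup>+zs. f zs \<partial>indep_list N (\<mu> # \<mu>s))
      = (\<integral>\<^sup>+y. \<integral>\<^sup>+zs. f zs \<partial>(?I \<bind> (\<lambda>ys. return ?C (y # ys))) \<partial>\<mu>)"
    unfolding indep_list.simps by (rule nn_integral_bind[OF f])
  also have "\<dots> = (\<integral>\<^sup>+y. \<integral>\<^sup>+ys. f (y # ys) \<partial>?I \<partial>\<mu>)"
  proof (rule nn_integral_cong)
    fix y assume "y \<in> space \<mu>"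
    then have [measurable]: "y \<in> space N" using sets_eq_imp_space_eq[OF sets(1)] by simp
    have "(\<integral>\<^sup>+zs. f zs \<partial>(?I \<bind> (\<lambda>ys. return ?C (y # ys))))
        = (\<integral>\<^sup>+ys. \<integral>\<^sup>+zs. f zs \<partial>return ?C (y # ys) \<partial>?I)"
      by (rule nn_integral_bind[OF f]) measurable
    also have "\<dots> = (\<integral>\<^sup>+ys. f (y # ys) \<partial>?I)"
      using \<open>y \<in> space N\<close> sets_eq_imp_space_eq[OF sets(2)]
      by (intro nn_integral_cong nn_integral_return) (auto simp: space_config_space f)
    finally show "(\<integral>\<^sup>+zs. f zs \<partial>(?I \<bind> (\<lambda>ys. return ?C (y # ys)))) = (\<integral>\<^sup>+ys. f (y # ys) \<partial>?I)" .
  qed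
  finally show ?thesis .
qed

lemma nn_integral_indep_list_prod:
  assumes "\<And>\<mu>. \<mu> \<in> set \<mu>s \<Longrightarrow> \<mu> \<in> space (subprob_algebra N)"
    and [measurable]: "h \<in> borel_measurable N"
  shows "(\<integral>\<^sup>+zs. (\<Prod>y\<leftarrow>zs. h y) \<partial>indep_list N \<mu>s) = (\<Prod>\<mu>\<leftarrow>\<mu>s. \<integral>\<^sup>+y. h y \<partial>\<mu>)"
  using assms(1)
proof (induction \<mu>s)
  case Nil
  then show ?case by (simp add: nn_integral_return)
next
  case (Cons \<mu> \<mu>s)
  have [measurable_cong]: "sets (indep_list N \<mu>s) = sets (config_space N)" "sets \<mu> = sets N"
    using indep_list_in_subprob_algebra[of \<mu>s N] Cons.prems by (auto simp: space_subprob_algebra)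
  show ?case
    using Cons by (simp add: nn_integral_indep_list_Cons nn_integral_cmult nn_integral_multc del: indep_list.simps)
qed

text \<open>Additive counterpart, now for probability measures: the count in one coordinate gets
  multiplied by the total masses of all the others.\<close>

lemma nn_integral_indep_list_num_in:
  assumes "\<And>\<mu>. \<mu> \<in> set \<mu>s \<Longrightarrow> \<mu> \<in> space (prob_algebra N)"
    and [measurable]: "A \<in> sets N"
  shows "(\<integral>\<^sup>+zs. of_nat (num_in A zs) \<partial>indep_list N \<mu>s) = (\<Sum>\<mu>\<leftarrow>\<mu>s. emeasure \<mu> A)"
  using assms(1)
proof (induction \<mu>s)
  case Nil
  show ?case
    using borel_measurable_num_in[OF assms(2)]
    by (simp add: nn_integral_return) (simp add: num_in_def)
next
  case (Cons \<mu> \<mu>s)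
  have I: "indep_list N \<mu>s \<in> space (prob_algebra (config_space N))"
    by (rule indep_list_in_prob_algebra) (simp add: Cons)
  then interpret I: prob_space "indep_list N \<mu>s" by (simp add: space_prob_algebra)
  have \<mu>: "\<mu> \<in> space (prob_algebra N)" using Cons by simp
  then interpret \<mu>: prob_space \<mu> by (simp add: space_prob_algebra)
  have [measurable_cong]: "sets (indep_list N \<mu>s) = sets (config_space N)" "sets \<mu> = sets N"
    using I \<mu> by (auto simp: space_prob_algebra)
  have *: "(of_nat (num_in A (y # ys)) :: ennreal) = indicator A y + of_nat (num_in A ys)" for y ys
    by (simp add: num_in_def)
  have **: "\<nu> \<in> space (subprob_algebra N)" if "\<nu> = \<mu> \<or> \<nu> \<in> set \<mu>s" for \<nu>
    using that Cons.prems by (auto simp: space_prob_algebra space_subprob_algebra prob_space_imp_subprob_space)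
  show ?case
    using Cons ** by (simp add: nn_integral_indep_list_Cons * nn_integral_add
      I.emeasure_space_1 \<mu>.emeasure_space_1 del: indep_list.simps)
qed

lemma LF_triplet_in_subprob_algebra:
  assumes "LF_triplet E K \<gamma> m"
  shows "\<gamma> \<in> space (subprob_algebra E)" "\<gamma> \<in> space (prob_algebra E)"
    and "x \<in> space E \<Longrightarrow> K x \<in> space (subprob_algebra E)"
  using LF_tripletD[OF assms]
  by (auto simp: space_subprob_algebra space_prob_algebra prob_space_imp_subprob_space)

section \<open>Integrals against the offspring law\<close>

text \<open>Conditioning on the number of children; its law is a density on \<open>nat\<close>, so
  the outer integral is a series.\<close>

lemma nn_integral_LF_offspring:
  assumes T: "LF_triplet E K \<gamma> m" and x: "x \<in> space E"
    and f: "f \<in> borel_measurable (config_space E)"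
  shows "(\<integral>\<^sup>+zs. f zs \<partial>LF_offspring E K \<gamma> m x) = (\<Sum>k. ennreal
     (if k = 0 then 1 - measure (K x) (space (K x))
      else measure (K x) (space (K x)) * (m ^ (k - 1) / (1 + m) ^ k)) *
     (\<integral>\<^sup>+zs. f zs \<partial>indep_list E (if k = 0 then [] else LF_marked K x # replicate (k - 1) \<gamma>)))"
proof -
  let ?I = "\<lambda>k. indep_list E (if k = 0 then [] else LF_marked K x # replicate (k - 1) \<gamma>)"
  have "?I k \<in> space (subprob_algebra (config_space E))" for k
    using measurable_space[OF measurable_LF_marked[OF T] x] LF_triplet_in_subprob_algebra(1)[OF T]
    by (intro indep_list_in_subprob_algebra) (auto split: if_splits)
  then have "?I \<in> LF_size K m x \<rightarrow>\<^sub>M subprob_algebra (config_space E)"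
    by (subst measurable_cong_sets[where M'="count_space UNIV", OF _ refl]) (auto simp: LF_size_def)
  from nn_integral_bind[OF f this] show ?thesis
    unfolding LF_offspring_def LF_size_def by (simp add: nn_integral_density nn_integral_count_space_nat)
qed

text \<open>Multiplying by the mass undoes the normalisation, also for mass zero, so the series for
  the generating functional avoids dividing by it.\<close>

lemma nn_integral_LF_marked:
  assumes T: "LF_triplet E K \<gamma> m" and x: "x \<in> space E" and [measurable]: "f \<in> borel_measurable E"
  shows "ennreal (measure (K x) (space (K x))) * (\<integral>\<^sup>+y. f y \<partial>LF_marked K x) = (\<integral>\<^sup>+y. f y \<partial>K x)"
proof -
  interpret subprob_space "K x" using x by (rule LF_tripletD[OF T])
  note [measurable_cong] = LF_tripletD(6)[OF T x]
  let ?p = "measure (K x) (space (K x))"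
  have *: "(\<integral>\<^sup>+y. f y \<partial>LF_marked K x) = 1 / ennreal ?p * (\<integral>\<^sup>+y. f y \<partial>K x)"
    unfolding LF_marked_def by (subst nn_integral_scale_measure) (auto simp: emeasure_eq_measure)
  show ?thesis
  proof (cases "?p = 0")
    \<comment> \<open>The normalising factor is infinite here, but
      \<open>0 * \<infinity> = 0\<close>, and \<open>K x\<close> integrates everything to
      zero.\<close>
    case True
    then have "AE y in K x. False"
      by (simp add: AE_iff_measurable[OF sets.top] emeasure_eq_measure)
    then have "(\<integral>\<^sup>+y. f y \<partial>K x) = (\<integral>\<^sup>+y. 0 \<partial>K x)" by (intro nn_integral_cong_AE) auto
    with True show ?thesis by simp
  next
    case False
    then have "ennreal ?p * (1 / ennreal ?p) = 1"
      by (simp add: ennreal_times_divide ennreal_divide_self measure_nonneg less_le)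
    then show ?thesis unfolding * mult.assoc[symmetric] by simp
  qed
qed

section \<open>Bounded functions, functions into the unit interval, and range of the
  functional\<close>

text \<open>A class preserved by all operators below, on which nonnegative and Bochner integrals
  against sub-probabilities agree. The bound may depend on \<open>f\<close>, since mean operators
  can increase it.\<close>

definition bounded_nonneg :: "'a measure \<Rightarrow> ('a \<Rightarrow> real) set" where
  "bounded_nonneg E = {f \<in> borel_measurable E. \<exists>B. f \<in> space E \<rightarrow> {0..B}}"

definition unit_function :: "'a measure \<Rightarrow> ('a \<Rightarrow> real) set" where
  "unit_function E = {h \<in> borel_measurable E. h \<in> space E \<rightarrow> {0..1}}"

lemma unit_function_bounded_nonneg: "h \<in> unit_function E \<Longrightarrow> h \<in> bounded_nonneg E"
  by (auto simp: unit_function_def bounded_nonneg_def)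

text \<open>Both sides of the first equation are 0 if the nonnegative integral is infinite, so it
  applies to \<open>add_measure\<close> before finiteness is known.\<close>

lemma integral_bounded_nonneg:
  assumes f: "f \<in> bounded_nonneg E" and s [measurable_cong]: "sets \<mu> = sets E"
  shows "(\<integral>y. f y \<partial>\<mu>) = enn2real (\<integral>\<^sup>+y. ennreal (f y) \<partial>\<mu>)"
    and "0 \<le> (\<integral>y. f y \<partial>\<mu>)"
proof -
  have [measurable]: "f \<in> borel_measurable E" and 0: "\<And>y. y \<in> space \<mu> \<Longrightarrow> 0 \<le> f y"
    using f sets_eq_imp_space_eq[OF s] by (auto simp: bounded_nonneg_def)
  show "(\<integral>y. f y \<partial>\<mu>) = enn2real (\<integral>\<^sup>+y. ennreal (f y) \<partial>\<mu>)"
    by (rule integral_eq_nn_integral) (auto intro!: AE_I2 simp: 0)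
  show "0 \<le> (\<integral>y. f y \<partial>\<mu>)" by (intro integral_nonneg_AE AE_I2) (simp add: 0)
qed

lemma nn_integral_bounded_nonneg:
  assumes f: "f \<in> bounded_nonneg E" and \<mu>: "\<mu> \<in> space (subprob_algebra E)"
  shows "(\<integral>\<^sup>+y. ennreal (f y) \<partial>\<mu>) = ennreal (\<integral>y. f y \<partial>\<mu>)" and "integrable \<mu> f"
proof -
  interpret subprob_space \<mu> using \<mu> by (simp add: space_subprob_algebra)
  have s [measurable_cong]: "sets \<mu> = sets E" using \<mu> by (simp add: space_subprob_algebra)
  obtain B where [measurable]: "f \<in> borel_measurable E"
    and B: "\<And>y. y \<in> space \<mu> \<Longrightarrow> 0 \<le> f y \<and> f y \<le> B"
    using f sets_eq_imp_space_eq[OF s] by (fastforce simp: bounded_nonneg_def Pi_iff)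
  show i: "integrable \<mu> f"
    by (rule integrable_const_bound[where B=B]) (auto intro!: AE_I2 simp: B)
  show "(\<integral>\<^sup>+y. ennreal (f y) \<partial>\<mu>) = ennreal (\<integral>y. f y \<partial>\<mu>)"
    by (rule nn_integral_eq_integral[OF i]) (auto intro!: AE_I2 simp: B)
qed

lemma integral_unit_function_le:
  assumes h: "h \<in> unit_function E" and \<mu>: "\<mu> \<in> space (subprob_algebra E)"
  shows "(\<integral>y. h y \<partial>\<mu>) \<le> measure \<mu> (space \<mu>)"
proof -
  interpret subprob_space \<mu> using \<mu> by (simp add: space_subprob_algebra)
  have "space \<mu> = space E" using \<mu> by (auto simp: space_subprob_algebra dest: sets_eq_imp_space_eq)
  then have "(\<integral>y. h y \<partial>\<mu>) \<le> (\<integral>y. 1 \<partial>\<mu>)"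
    using h nn_integral_bounded_nonneg(2)[OF unit_function_bounded_nonneg[OF h] \<mu>]
    by (intro integral_mono) (auto simp: unit_function_def Pi_iff)
  then show ?thesis by simp
qed

text \<open>As \<open>\<gamma>\<close> is a probability measure and \<open>h \<le> 1\<close>, the
  subtracted term is at most \<open>m\<close>.\<close>

lemma LF_denominator_ge_1:
  assumes "LF_triplet E K \<gamma> m" "h \<in> unit_function E"
  shows "1 + m - m * (\<integral>y. h y \<partial>\<gamma>) \<ge> 1"
proof -
  interpret prob_space \<gamma> by (rule LF_tripletD[OF assms(1)])
  have "(\<integral>y. h y \<partial>\<gamma>) \<le> 1"
    using integral_unit_function_le[OF assms(2) LF_triplet_in_subprob_algebra(1)[OF assms(1)]]
    by (simp add: prob_space)
  then show ?thesis using LF_tripletD(5)[OF assms(1)] by simp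
qed

text \<open>The fraction lies between 0 and the \<open>K x\<close>-integral of \<open>h\<close>,
  hence is at most the mass of \<open>K x\<close>. This is what allows iteration.\<close>

lemma LF_gf_unit_function:
  assumes T: "LF_triplet E K \<gamma> m" and h: "h \<in> unit_function E"
  shows "LF_gf K \<gamma> m h \<in> unit_function E"
proof -
  note [measurable] = LF_tripletD(1)[OF T]
  have [measurable]: "h \<in> borel_measurable E" using h by (simp add: unit_function_def)
  let ?D = "1 + m - m * (\<integral>y. h y \<partial>\<gamma>)"
  have D: "?D \<ge> 1" by (rule LF_denominator_ge_1[OF T h])
  have [measurable]: "(\<lambda>x. \<integral>y. h y \<partial>K x) \<in> borel_measurable E"
    using measurable_compose[OF LF_tripletD(1)[OF T] integral_measurable_subprob_algebra[of h E]] by simp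
  have "(\<lambda>x. 1 - measure (K x) (space E) + (\<integral>y. h y \<partial>K x) / ?D) \<in> borel_measurable E" by measurable
  then have "LF_gf K \<gamma> m h \<in> borel_measurable E"
    unfolding LF_gf_def[abs_def]
    by (rule measurable_cong[THEN iffD1, rotated]) (simp add: LF_tripletD(7)[OF T])
  moreover have "LF_gf K \<gamma> m h x \<in> {0..1}" if x: "x \<in> space E" for x
  proof -
    interpret subprob_space "K x" using x by (rule LF_tripletD[OF T])
    note integral_bounded_nonneg(2)[OF unit_function_bounded_nonneg[OF h] LF_tripletD(6)[OF T x]]
      integral_unit_function_le[OF h LF_triplet_in_subprob_algebra(3)[OF T x]]
    moreover have "(\<integral>y. h y \<partial>K x) / ?D \<le> (\<integral>y. h y \<partial>K x)"
      using D calculation(1) by (simp add: divide_le_eq mult_le_cancel_left1)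
    moreover have "0 \<le> (\<integral>y. h y \<partial>K x) / ?D" using D calculation(1) by simp
    ultimately show ?thesis using subprob_measure_le_1[of "space (K x)"] by (simp add: LF_gf_def)
  qed
  ultimately show ?thesis by (auto simp: unit_function_def)
qed

section \<open>Generating functional and mean of the offspring law\<close>

text \<open>The weight of \<open>k \<ge> 1\<close> children together with the marked child gives
  \<open>a * m ^ (k - 1) / (1 + m) ^ k\<close>, the other children give \<open>g ^ (k - 1)\<close>:
  a geometric series of ratio \<open>m * g / (1 + m)\<close>.\<close>

lemma LF_offspring_gf:
  assumes T: "LF_triplet E K \<gamma> m" and x: "x \<in> space E" and h: "h \<in> unit_function E"
  shows "(\<integral>\<^sup>+zs. (\<Prod>y\<leftarrow>zs. ennreal (h y)) \<partial>LF_offspring E K \<gamma> m x) = ennreal (LF_gf K \<gamma> m h x)"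
proof -
  interpret subprob_space "K x" using x by (rule LF_tripletD[OF T])
  interpret \<gamma>: prob_space \<gamma> by (rule LF_tripletD[OF T])
  have m: "0 < m" by (rule LF_tripletD[OF T])
  have [measurable]: "h \<in> borel_measurable E" using h by (simp add: unit_function_def)
  define p where "p = measure (K x) (space (K x))"
  define a where "a = (\<integral>y. h y \<partial>K x)"
  define g where "g = (\<integral>y. h y \<partial>\<gamma>)"
  have p: "p \<le> 1" by (simp add: p_def subprob_measure_le_1)
  note h' = unit_function_bounded_nonneg[OF h]
  note \<gamma> = LF_triplet_in_subprob_algebra(1)[OF T] and K = LF_triplet_in_subprob_algebra(3)[OF T x]
  have a: "(\<integral>\<^sup>+y. ennreal (h y) \<partial>K x) = ennreal a" "0 \<le> a"
    using nn_integral_bounded_nonneg(1)[OF h' K] integral_bounded_nonneg(2)[OF h' LF_tripletD(6)[OF T x]]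
    by (simp_all add: a_def)
  have g: "(\<integral>\<^sup>+y. ennreal (h y) \<partial>\<gamma>) = ennreal g" "0 \<le> g" "g \<le> 1"
    using nn_integral_bounded_nonneg(1)[OF h' \<gamma>] integral_bounded_nonneg(2)[OF h' LF_tripletD(3)[OF T]]
      integral_unit_function_le[OF h \<gamma>]
    by (simp_all add: g_def \<gamma>.prob_space)
  let ?t = "\<lambda>k. if k = 0 then 1 - p else a * (m ^ (k - 1) / (1 + m) ^ k) * g ^ (k - 1)"
  \<comment> \<open>The ratio stays below 1 even for \<open>g = 1\<close>.\<close>
  have "m * g < 1 + m" using m g mult_left_mono[of g 1 m] by linarith
  then have "(\<lambda>k. (m * g / (1 + m)) ^ k) sums (1 / (1 - m * g / (1 + m)))"
    using m g by (intro geometric_sums) (simp add: abs_mult)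
  then have "(\<lambda>k. a / (1 + m) * (m * g / (1 + m)) ^ k) sums (a / (1 + m) * (1 / (1 - m * g / (1 + m))))"
    by (rule sums_mult)
  also have "a / (1 + m) * (1 / (1 - m * g / (1 + m))) = a / (1 + m - m * g)"
    using m by (simp add: divide_simps)
  also have "(\<lambda>k. a / (1 + m) * (m * g / (1 + m)) ^ k) = (\<lambda>k. ?t (Suc k))"
    by (simp add: power_divide power_mult_distrib mult_ac)
  finally have "?t sums (1 - p + a / (1 + m - m * g))" 
    using sums_Suc_iff[of ?t "a / (1 + m - m * g)"] by (simp add: add.commute)
  then have S: "?t sums LF_gf K \<gamma> m h x" by (simp add: LF_gf_def p_def a_def g_def)
  have t: "?t k \<ge> 0" for k using p a g m by simp
  have "(\<integral>\<^sup>+zs. (\<Prod>y\<leftarrow>zs. ennreal (h y)) \<partial>LF_offspring E K \<gamma> m x) = (\<Sum>k. ennreal (?t k))"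
  proof (subst nn_integral_LF_offspring[OF T x], measurable, rule suminf_cong)
    fix k
    show "ennreal (if k = 0 then 1 - measure (K x) (space (K x))
        else measure (K x) (space (K x)) * (m ^ (k - 1) / (1 + m) ^ k)) *
      (\<integral>\<^sup>+zs. (\<Prod>y\<leftarrow>zs. ennreal (h y)) \<partial>indep_list E (if k = 0 then [] else LF_marked K x # replicate (k - 1) \<gamma>))
      = ennreal (?t k)"
    proof (cases k)
      case 0
      then show ?thesis
        by (subst nn_integral_indep_list_prod) (auto simp: p_def)
    next
      case (Suc j)
      let ?J = "\<integral>\<^sup>+y. ennreal (h y) \<partial>LF_marked K x"
      have "ennreal (p * (m ^ j / (1 + m) ^ k)) *
        (\<integral>\<^sup>+zs. (\<Prod>y\<leftarrow>zs. ennreal (h y)) \<partial>indep_list E (LF_marked K x # replicate j \<gamma>))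
        = ennreal (p * (m ^ j / (1 + m) ^ k)) * (?J * ennreal g ^ j)"
        using measurable_space[OF measurable_LF_marked[OF T] x] \<gamma>
        by (subst nn_integral_indep_list_prod) (auto simp: g prod_list_replicate)
      also have "\<dots> = ennreal p * ?J * (ennreal (m ^ j / (1 + m) ^ k) * ennreal g ^ j)"
        using m by (subst ennreal_mult) (simp_all add: p_def mult_ac)
      also have "ennreal p * ?J = ennreal a"
        using nn_integral_LF_marked[OF T x, of "\<lambda>y. ennreal (h y)"] a by (simp add: p_def)
      also have "ennreal a * (ennreal (m ^ j / (1 + m) ^ k) * ennreal g ^ j) =
          ennreal (a * (m ^ j / (1 + m) ^ k) * g ^ j)"
      proof -
        have "ennreal a * (ennreal c * ennreal g ^ j) = ennreal (a * c * g ^ j)" if "0 \<le> c" for c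
          using a(2) g(2) that by (simp add: ennreal_mult ennreal_power mult.assoc)
        then show ?thesis using m by simp
      qed
      finally show ?thesis
        unfolding Suc by (simp add: p_def del: indep_list.simps power_Suc)
    qed
  qed
  also have "\<dots> = ennreal (LF_gf K \<gamma> m h x)"
    using S t by (subst suminf_ennreal2) (auto simp: sums_iff)
  finally show ?thesis .
qed

text \<open>Weighted by the mass of \<open>K x\<close>, the marked child has law \<open>K x\<close>,
  and the expected number of unmarked children is that mass times \<open>m\<close>.\<close>

lemma LF_offspring_mean:
  assumes T: "LF_triplet E K \<gamma> m" and x: "x \<in> space E" and A [measurable]: "A \<in> sets E"
  shows "(\<integral>\<^sup>+zs. of_nat (num_in A zs) \<partial>LF_offspring E K \<gamma> m x) =
    emeasure (K x) A + ennreal (measure (K x) (space (K x)) * m) * emeasure \<gamma> A"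
proof -
  interpret subprob_space "K x" using x by (rule LF_tripletD[OF T])
  interpret \<gamma>: prob_space \<gamma> by (rule LF_tripletD[OF T])
  have m: "0 < m" by (rule LF_tripletD[OF T])
  define p where "p = measure (K x) (space (K x))"
  define a where "a = measure (K x) A"
  define g where "g = measure \<gamma> A"
  let ?c = "\<lambda>k. m ^ (k - 1) / (1 + m) ^ k"
  let ?t = "\<lambda>k. if k = 0 then 0 else a * ?c k + p * g * (real (k - 1) * ?c k)"
  have 1: "(\<lambda>k. ?c (Suc k)) sums 1"
    using LF_size_sums[OF m, of 1] sums_Suc_iff[of "\<lambda>k. if k = 0 then 0 else ?c k" 1] by (simp cong: if_cong)
  \<comment> \<open>Derivative of the geometric series at \<open>m / (1 + m)\<close>, scaled so that
    its terms are \<open>(k + 1) * ?c (k + 2)\<close>; the vanishing term at 0 is restored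
    afterwards.\<close>
  have "(\<lambda>k. (m / (1 + m)) ^ 2 * (of_nat (Suc k) * (m / (1 + m)) ^ k) / m) sums
      ((m / (1 + m)) ^ 2 * (1 / (1 - m / (1 + m))\<^sup>2) / m)"
    using m by (intro sums_mult sums_divide geometric_deriv_sums) auto
  also have "(m / (1 + m)) ^ 2 * (1 / (1 - m / (1 + m))\<^sup>2) / m = m"
    using m by (simp add: divide_simps power2_eq_square)
  also have "(\<lambda>k. (m / (1 + m)) ^ 2 * (of_nat (Suc k) * (m / (1 + m)) ^ k) / m) =
      (\<lambda>k. real (Suc k) * ?c (Suc (Suc k)))"
    using m by (simp add: power_divide power2_eq_square fun_eq_iff)
  finally have 2: "(\<lambda>k. real k * ?c (Suc k)) sums m"
    using sums_Suc_iff[of "\<lambda>k. real k * ?c (Suc k)" m] by simp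
  have "(\<lambda>k. a * ?c (Suc k) + p * g * (real k * ?c (Suc k))) sums (a * 1 + p * g * m)"
    by (intro sums_add sums_mult 1 2)
  then have S: "?t sums (a + p * m * g)"
    using sums_Suc_iff[of ?t "a + p * m * g"] by (simp add: mult_ac)
  have t: "?t k \<ge> 0" for k using m by (simp add: a_def p_def g_def)
  have "(\<integral>\<^sup>+zs. of_nat (num_in A zs) \<partial>LF_offspring E K \<gamma> m x) = (\<Sum>k. ennreal (?t k))"
  proof (subst nn_integral_LF_offspring[OF T x], measurable, rule suminf_cong)
    fix k
    show "ennreal (if k = 0 then 1 - measure (K x) (space (K x))
        else measure (K x) (space (K x)) * (m ^ (k - 1) / (1 + m) ^ k)) *
      (\<integral>\<^sup>+zs. of_nat (num_in A zs) \<partial>indep_list E (if k = 0 then [] else LF_marked K x # replicate (k - 1) \<gamma>))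
      = ennreal (?t k)"
    proof (cases "k = 0 \<or> p = 0")
      \<comment> \<open>For \<open>p = 0\<close> the marked law is not a probability measure and the
        counting lemma does not apply; then \<open>a \<le> p\<close> makes every term
        vanish.\<close>
      case True
      moreover have "a = 0" if "p = 0"
        using that finite_measure_mono[of A "space (K x)"] A LF_tripletD(6,7)[OF T x] sets.sets_into_space[OF A]
        by (simp add: a_def p_def measure_le_0_iff)
      moreover have "(\<integral>\<^sup>+zs. of_nat (num_in A zs) \<partial>indep_list E []) = 0"
        using nn_integral_indep_list_num_in[of "[]" E A] A by simp
      ultimately show ?thesis
        unfolding p_def by (cases "k = 0") (simp_all del: indep_list.simps)
    next
      case False
      then obtain j where Suc: "k = Suc j" by (cases k) auto
      have "LF_marked K x \<in> space (prob_algebra E)"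
        using prob_space_LF_marked[OF T x] False measurable_space[OF measurable_LF_marked[OF T] x]
        by (auto simp: space_prob_algebra space_subprob_algebra p_def)
      then have "(\<integral>\<^sup>+zs. of_nat (num_in A zs) \<partial>indep_list E (LF_marked K x # replicate j \<gamma>))
        = emeasure (LF_marked K x) A + of_nat j * ennreal g"
        using LF_triplet_in_subprob_algebra(2)[OF T]
        by (subst nn_integral_indep_list_num_in)
           (auto simp: g_def sum_list_replicate \<gamma>.emeasure_eq_measure)
      moreover have "emeasure (LF_marked K x) A = ennreal (a / p)"
        using False unfolding emeasure_LF_marked emeasure_eq_measure a_def p_def
        by (intro divide_ennreal) (simp_all add: zero_less_measure_iff)
      ultimately have I: "(\<integral>\<^sup>+zs. of_nat (num_in A zs) \<partial>indep_list E (LF_marked K x # replicate j \<gamma>))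
        = ennreal (a / p + real j * g)"
        by (simp add: a_def p_def g_def ennreal_mult ennreal_of_nat_eq_real_of_nat)
      have "p * c * (a / p + real j * g) = a * c + p * g * (real j * c)" for c
        using False by (simp add: field_simps)
      then have "ennreal (p * ?c k) * ennreal (a / p + real j * g) = ennreal (?t k)"
        using m Suc by (subst ennreal_mult'[symmetric]) (simp_all add: p_def add_divide_distrib)
      with I show ?thesis
        using Suc by (simp add: p_def del: indep_list.simps power_Suc)
    qed
  qed
  also have "\<dots> = ennreal (a + p * m * g)"
    using S t by (subst suminf_ennreal2) (auto simp: sums_iff)
  also have "\<dots> = emeasure (K x) A + ennreal (measure (K x) (space (K x)) * m) * emeasure \<gamma> A"
    using m by (simp add: a_def p_def g_def emeasure_eq_measure \<gamma>.emeasure_eq_measure ennreal_mult)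
  finally show ?thesis .
qed

section \<open>The generating functional of generation n\<close>

text \<open>The branching property: a product over a concatenation is a product over the independent
  lists of children, so \<open>nn_integral_indep_list_prod\<close> applies one level up, with lists
  as points.\<close>

lemma nn_integral_LF_step_prod:
  assumes T: "LF_triplet E K \<gamma> m" and h: "h \<in> unit_function E" and xs: "xs \<in> space (config_space E)"
  shows "(\<integral>\<^sup>+zs. (\<Prod>y\<leftarrow>zs. ennreal (h y)) \<partial>LF_step E K \<gamma> m xs) = (\<Prod>x\<leftarrow>xs. ennreal (LF_gf K \<gamma> m h x))"
proof -
  let ?C = "config_space E" and ?\<mu>s = "map (LF_offspring E K \<gamma> m) xs"
  have [measurable]: "h \<in> borel_measurable E" using h by (simp add: unit_function_def)
  have \<mu>s: "\<mu> \<in> space (subprob_algebra ?C)" if "\<mu> \<in> set ?\<mu>s" for \<mu>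
    using that xs measurable_space[OF measurable_prob_algebraD[OF measurable_LF_offspring[OF T]]]
    by (auto simp: space_config_space)
  have [measurable_cong]: "sets (indep_list ?C ?\<mu>s) = sets (config_space ?C)"
    using indep_list_in_subprob_algebra[of ?\<mu>s, OF \<mu>s] by (simp add: space_subprob_algebra)
  have "(\<Prod>y\<leftarrow>concat zss. ennreal (h y)) = (\<Prod>zs\<leftarrow>zss. \<Prod>y\<leftarrow>zs. ennreal (h y))" for zss
    by (induction zss) auto
  then have "(\<integral>\<^sup>+zs. (\<Prod>y\<leftarrow>zs. ennreal (h y)) \<partial>LF_step E K \<gamma> m xs) =
      (\<integral>\<^sup>+zss. (\<Prod>zs\<leftarrow>zss. \<Prod>y\<leftarrow>zs. ennreal (h y)) \<partial>indep_list ?C ?\<mu>s)"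
    unfolding LF_step_def by (subst nn_integral_distr) auto
  also have "\<dots> = (\<Prod>\<mu>\<leftarrow>?\<mu>s. \<integral>\<^sup>+zs. (\<Prod>y\<leftarrow>zs. ennreal (h y)) \<partial>\<mu>)"
    using \<mu>s by (intro nn_integral_indep_list_prod) auto
  also have "\<dots> = (\<Prod>x\<leftarrow>xs. ennreal (LF_gf K \<gamma> m h x))"
    using xs LF_offspring_gf[OF T _ h]
    by (auto simp: space_config_space comp_def in_lists_conv_set intro!: arg_cong[of _ _ prod_list] map_cong)
  finally show ?thesis .
qed

text \<open>Unconditional form of the last clause of \<open>LF_process\<close>, taking the whole
  path space as \<open>H\<close>.\<close>

lemma distr_LF_process_Suc:
  assumes T: "LF_triplet E K \<gamma> m" and P: "LF_process E K \<gamma> m x \<Omega> Z"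
  shows "distr \<Omega> (config_space E) (Z (Suc n)) = \<Omega> \<bind> (\<lambda>\<omega>. LF_step E K \<gamma> m (Z n \<omega>))"
proof (rule measure_eqI)
  let ?C = "config_space E"
  have [measurable]: "Z n \<in> \<Omega> \<rightarrow>\<^sub>M ?C" for n using P by (simp add: LF_process_def)
  interpret prob_space \<Omega> using P by (simp add: LF_process_def)
  have L: "(\<lambda>\<omega>. LF_step E K \<gamma> m (Z n \<omega>)) \<in> \<Omega> \<rightarrow>\<^sub>M subprob_algebra ?C"
    using measurable_prob_algebraD[OF measurable_LF_step[OF T]] by measurable
  then have "sets (\<Omega> \<bind> (\<lambda>\<omega>. LF_step E K \<gamma> m (Z n \<omega>))) = sets ?C"
    by (intro sets_bind not_empty) (auto dest: subprob_measurableD(2))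
  then show "sets (distr \<Omega> ?C (Z (Suc n))) = sets (\<Omega> \<bind> (\<lambda>\<omega>. LF_step E K \<gamma> m (Z n \<omega>)))"
    by simp
  fix B assume "B \<in> sets (distr \<Omega> ?C (Z (Suc n)))"
  then have B [measurable]: "B \<in> sets ?C" by simp
  let ?H = "space (PiM {..n} (\<lambda>_. ?C))"
  have H: "(\<lambda>i\<in>{..n}. Z i \<omega>) \<in> ?H" if "\<omega> \<in> space \<Omega>" for \<omega>
    using that by (auto simp: space_PiM intro!: measurable_space[of "Z _" \<Omega> ?C])
  have "emeasure (distr \<Omega> ?C (Z (Suc n))) B =
      emeasure \<Omega> {\<omega> \<in> space \<Omega>. (\<lambda>i\<in>{..n}. Z i \<omega>) \<in> ?H \<and> Z (Suc n) \<omega> \<in> B}"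
    using H by (auto simp: emeasure_distr intro!: arg_cong[of _ _ "emeasure \<Omega>"])
  also have "\<dots> = (\<integral>\<^sup>+\<omega>. indicator ?H (\<lambda>i\<in>{..n}. Z i \<omega>) * emeasure (LF_step E K \<gamma> m (Z n \<omega>)) B \<partial>\<Omega>)"
    using P B unfolding LF_process_def by blast
  also have "\<dots> = (\<integral>\<^sup>+\<omega>. emeasure (LF_step E K \<gamma> m (Z n \<omega>)) B \<partial>\<Omega>)"
    using H by (intro nn_integral_cong) simp
  also have "\<dots> = emeasure (\<Omega> \<bind> (\<lambda>\<omega>. LF_step E K \<gamma> m (Z n \<omega>))) B"
    by (rule emeasure_bind[OF not_empty L B, symmetric])
  finally show "emeasure (distr \<Omega> ?C (Z (Suc n))) B = emeasure (\<Omega> \<bind> (\<lambda>\<omega>. LF_step E K \<gamma> m (Z n \<omega>))) B" .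
qed

text \<open>The induction step trades generation \<open>Suc n\<close> at \<open>h\<close> for
  generation \<open>n\<close> at \<open>LF_gf K \<gamma> m h\<close>, so \<open>h\<close> varies in
  the induction.\<close>

lemma nn_integral_LF_process_prod:
  assumes T: "LF_triplet E K \<gamma> m" and x: "x \<in> space E"
    and P: "LF_process E K \<gamma> m x \<Omega> Z" and h: "h \<in> unit_function E"
  shows "(\<integral>\<^sup>+\<omega>. (\<Prod>y\<leftarrow>Z n \<omega>. ennreal (h y)) \<partial>\<Omega>) = ennreal ((LF_gf K \<gamma> m ^^ n) h x)"
  using h
proof (induction n arbitrary: h)
  let ?C = "config_space E"
  have [measurable]: "Z n \<in> \<Omega> \<rightarrow>\<^sub>M ?C" for n using P by (simp add: LF_process_def)
  {
    case 0
    then have [measurable]: "h \<in> borel_measurable E" by (simp add: unit_function_def)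
    have "(\<integral>\<^sup>+\<omega>. (\<Prod>y\<leftarrow>Z 0 \<omega>. ennreal (h y)) \<partial>\<Omega>) = (\<integral>\<^sup>+zs. (\<Prod>y\<leftarrow>zs. ennreal (h y)) \<partial>distr \<Omega> ?C (Z 0))"
      by (subst nn_integral_distr) auto
    also have "distr \<Omega> ?C (Z 0) = return ?C [x]" using P by (simp add: LF_process_def)
    also have "(\<integral>\<^sup>+zs. (\<Prod>y\<leftarrow>zs. ennreal (h y)) \<partial>return ?C [x]) = ennreal (h x)"
      using x by (subst nn_integral_return) (auto simp: space_config_space)
    finally show ?case by simp
  next
    case (Suc n)
    then have [measurable]: "h \<in> borel_measurable E" by (simp add: unit_function_def)
    have L: "(\<lambda>\<omega>. LF_step E K \<gamma> m (Z n \<omega>)) \<in> \<Omega> \<rightarrow>\<^sub>M subprob_algebra ?C"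
      using measurable_prob_algebraD[OF measurable_LF_step[OF T]] by measurable
    have "(\<integral>\<^sup>+\<omega>. (\<Prod>y\<leftarrow>Z (Suc n) \<omega>. ennreal (h y)) \<partial>\<Omega>) =
        (\<integral>\<^sup>+zs. (\<Prod>y\<leftarrow>zs. ennreal (h y)) \<partial>distr \<Omega> ?C (Z (Suc n)))"
      by (subst nn_integral_distr) auto
    also have "\<dots> = (\<integral>\<^sup>+\<omega>. \<integral>\<^sup>+zs. (\<Prod>y\<leftarrow>zs. ennreal (h y)) \<partial>LF_step E K \<gamma> m (Z n \<omega>) \<partial>\<Omega>)"
      unfolding distr_LF_process_Suc[OF T P] by (rule nn_integral_bind[OF _ L]) measurable
    also have "\<dots> = (\<integral>\<^sup>+\<omega>. (\<Prod>y\<leftarrow>Z n \<omega>. ennreal (LF_gf K \<gamma> m h y)) \<partial>\<Omega>)"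
      using Suc.prems by (intro nn_integral_cong nn_integral_LF_step_prod[OF T] measurable_space[of "Z n" \<Omega>]) auto
    also have "\<dots> = ennreal ((LF_gf K \<gamma> m ^^ n) (LF_gf K \<gamma> m h) x)"
      by (rule Suc.IH) (rule LF_gf_unit_function[OF T Suc.prems])
    finally show ?case by (simp add: funpow_swap1)
  }
qed

lemma funpow_LF_gf_unit_function:
  assumes "LF_triplet E K \<gamma> m" "h \<in> unit_function E"
  shows "(LF_gf K \<gamma> m ^^ n) h \<in> unit_function E"
  by (induction n) (auto simp: assms LF_gf_unit_function)

lemma LF_process_gf:
  assumes T: "LF_triplet E K \<gamma> m" and x: "x \<in> space E"
    and P: "LF_process E K \<gamma> m x \<Omega> Z" and h: "h \<in> unit_function E"
  shows "(\<integral>\<omega>. (\<Prod>y\<leftarrow>Z n \<omega>. h y) \<partial>\<Omega>) = (LF_gf K \<gamma> m ^^ n) h x"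
proof -
  have [measurable]: "Z n \<in> \<Omega> \<rightarrow>\<^sub>M config_space E" using P by (simp add: LF_process_def)
  have [measurable]: "h \<in> borel_measurable E" using h by (simp add: unit_function_def)
  let ?G = "\<lambda>zs. \<Prod>y\<leftarrow>zs. ennreal (h y)"
  have G: "?G zs = ennreal (\<Prod>y\<leftarrow>zs. h y) \<and> 0 \<le> (\<Prod>y\<leftarrow>zs. h y)" if "zs \<in> lists (space E)" for zs
    using that h by (induction zs) (auto simp: unit_function_def ennreal_mult Pi_iff)
  have Z: "Z n \<omega> \<in> lists (space E)" if "\<omega> \<in> space \<Omega>" for \<omega>
    using measurable_space[of "Z n" \<Omega> "config_space E", OF _ that] by (simp add: space_config_space)
  have Gm: "(\<lambda>\<omega>. ?G (Z n \<omega>)) \<in> borel_measurable \<Omega>"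
    by (rule measurable_compose[where N="config_space E"]) measurable
  \<comment> \<open>Measurability was established for the \<open>ennreal\<close> product, so the
    real product is rewritten through it.\<close>
  have "(\<integral>\<omega>. (\<Prod>y\<leftarrow>Z n \<omega>. h y) \<partial>\<Omega>) = (\<integral>\<omega>. enn2real (?G (Z n \<omega>)) \<partial>\<Omega>)"
    using Z G by (intro Bochner_Integration.integral_cong) auto
  also have "\<dots> = enn2real (\<integral>\<^sup>+\<omega>. ennreal (enn2real (?G (Z n \<omega>))) \<partial>\<Omega>)"
    by (rule integral_eq_nn_integral[OF borel_measurable_enn2real[OF Gm]]) simp
  also have "(\<integral>\<^sup>+\<omega>. ennreal (enn2real (?G (Z n \<omega>))) \<partial>\<Omega>) = (\<integral>\<^sup>+\<omega>. ?G (Z n \<omega>) \<partial>\<Omega>)"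
    using Z G by (intro nn_integral_cong) auto
  also have "\<dots> = ennreal ((LF_gf K \<gamma> m ^^ n) h x)"
    by (rule nn_integral_LF_process_prod[OF T x P h])
  finally show ?thesis
    using funpow_LF_gf_unit_function[OF T h, of n] x by (auto simp: unit_function_def Pi_iff)
qed

section \<open>Mean operators\<close>

text \<open>The measure \<open>c \<mu> + d \<nu>\<close>, as a mixture over the two-point space.\<close>

definition add_measure :: "real \<Rightarrow> 'a measure \<Rightarrow> real \<Rightarrow> 'a measure \<Rightarrow> 'a measure" where
  "add_measure c \<mu> d \<nu> =
     density (count_space UNIV) (\<lambda>b. ennreal (if b then c else d)) \<bind> (\<lambda>b. if b then \<mu> else \<nu>)"

lemma add_measure:
  assumes \<mu>: "\<mu> \<in> space (subprob_algebra E)" and \<nu>: "\<nu> \<in> space (subprob_algebra E)"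
  shows sets_add_measure: "sets (add_measure c \<mu> d \<nu>) = sets E"
    and space_add_measure: "space (add_measure c \<mu> d \<nu>) = space E"
    and nn_integral_add_measure: "f \<in> borel_measurable E \<Longrightarrow>
      (\<integral>\<^sup>+y. f y \<partial>add_measure c \<mu> d \<nu>) = ennreal c * (\<integral>\<^sup>+y. f y \<partial>\<mu>) + ennreal d * (\<integral>\<^sup>+y. f y \<partial>\<nu>)"
    and emeasure_add_measure: "A \<in> sets E \<Longrightarrow>
      emeasure (add_measure c \<mu> d \<nu>) A = ennreal c * emeasure \<mu> A + ennreal d * emeasure \<nu> A"
proof -
  let ?D = "density (count_space UNIV) (\<lambda>b. ennreal (if b then c else d))"
  show s: "sets (add_measure c \<mu> d \<nu>) = sets E"
    unfolding add_measure_def using \<mu> \<nu> by (intro sets_bind) (auto simp: space_subprob_algebra)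
  then show "space (add_measure c \<mu> d \<nu>) = space E" by (rule sets_eq_imp_space_eq)
  have m: "(\<lambda>b. if b then \<mu> else \<nu>) \<in> ?D \<rightarrow>\<^sub>M subprob_algebra E"
    using \<mu> \<nu> by (subst measurable_cong_sets[where M'="count_space UNIV", OF _ refl]) auto
  show nn: "(\<integral>\<^sup>+y. f y \<partial>add_measure c \<mu> d \<nu>) = ennreal c * (\<integral>\<^sup>+y. f y \<partial>\<mu>) + ennreal d * (\<integral>\<^sup>+y. f y \<partial>\<nu>)"
    if "f \<in> borel_measurable E" for f
    unfolding add_measure_def nn_integral_bind[OF that m]
    by (simp add: nn_integral_density nn_integral_count_space_finite UNIV_bool add.commute)
  have "sets \<mu> = sets E" "sets \<nu> = sets E" using \<mu> \<nu> by (auto simp: space_subprob_algebra)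
  then show "A \<in> sets E \<Longrightarrow>
      emeasure (add_measure c \<mu> d \<nu>) A = ennreal c * emeasure \<mu> A + ennreal d * emeasure \<nu> A"
    using nn[of "indicator A"] by (simp add: s)
qed

text \<open>The signs of \<open>c\<close> and \<open>d\<close> matter: \<open>ennreal\<close>
  truncates negative coefficients to 0.\<close>

lemma integral_add_measure:
  assumes \<mu>: "\<mu> \<in> space (subprob_algebra E)" and \<nu>: "\<nu> \<in> space (subprob_algebra E)"
    and "0 \<le> c" "0 \<le> d" and f: "f \<in> bounded_nonneg E"
  shows "(\<integral>y. f y \<partial>add_measure c \<mu> d \<nu>) = c * (\<integral>y. f y \<partial>\<mu>) + d * (\<integral>y. f y \<partial>\<nu>)"
proof -
  have [measurable]: "f \<in> borel_measurable E" using f by (simp add: bounded_nonneg_def)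
  have s: "sets \<mu> = sets E" "sets \<nu> = sets E" using \<mu> \<nu> by (auto simp: space_subprob_algebra)
  note nn = integral_bounded_nonneg(2)[OF f s(1)] integral_bounded_nonneg(2)[OF f s(2)]
  have "(\<integral>\<^sup>+y. ennreal (f y) \<partial>add_measure c \<mu> d \<nu>) = ennreal (c * (\<integral>y. f y \<partial>\<mu>) + d * (\<integral>y. f y \<partial>\<nu>))"
    using assms nn by (simp add: nn_integral_add_measure nn_integral_bounded_nonneg ennreal_mult)
  then show ?thesis
    using nn assms by (simp add: integral_bounded_nonneg(1)[OF f sets_add_measure[OF \<mu> \<nu>]]
      ennreal_plus[symmetric] del: ennreal_plus)
qed

section \<open>Kernels as operators on bounded functions\<close>

lemma kernel_integral_bounded_nonneg:
  assumes K: "K \<in> E \<rightarrow>\<^sub>M subprob_algebra E" and f: "f \<in> bounded_nonneg E"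
  shows "(\<lambda>y. \<integral>z. f z \<partial>K y) \<in> bounded_nonneg E"
proof -
  obtain B where fm [measurable]: "f \<in> borel_measurable E" and B: "\<And>y. y \<in> space E \<Longrightarrow> 0 \<le> f y \<and> f y \<le> B"
    using f by (fastforce simp: bounded_nonneg_def Pi_iff)
  \<comment> \<open>A nonnegative constant does not grow when integrated against mass at most 1;
    hence \<open>max 0 B\<close>.\<close>
  have "0 \<le> (\<integral>z. f z \<partial>K y) \<and> (\<integral>z. f z \<partial>K y) \<le> max 0 B" if y: "y \<in> space E" for y
  proof
    have Ky: "K y \<in> space (subprob_algebra E)" using measurable_space[OF K y] .
    then interpret subprob_space "K y" by (simp add: space_subprob_algebra)
    have s: "sets (K y) = sets E" using Ky by (simp add: space_subprob_algebra)
    show "0 \<le> (\<integral>z. f z \<partial>K y)" by (rule integral_bounded_nonneg(2)[OF f s])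
    have "(\<integral>z. f z \<partial>K y) \<le> (\<integral>z. max 0 B \<partial>K y)"
      using B nn_integral_bounded_nonneg(2)[OF f Ky] sets_eq_imp_space_eq[OF s]
      by (intro integral_mono) (auto simp: le_max_iff_disj)
    also have "\<dots> \<le> max 0 B" using subprob_measure_le_1[of "space (K y)"] by (simp add: mult_left_le_one_le)
    finally show "(\<integral>z. f z \<partial>K y) \<le> max 0 B" .
  qed
  moreover have "(\<lambda>y. \<integral>z. f z \<partial>K y) \<in> borel_measurable E"
    using measurable_compose[OF K integral_measurable_subprob_algebra[OF fm]] by simp
  ultimately show ?thesis by (auto simp: bounded_nonneg_def intro!: exI[of _ "max 0 B"])
qed

text \<open>The identity holds for nonnegative integrals, and boundedness carries it over to Bochner
  integrals.\<close>

lemma integral_bind_bounded_nonneg: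
  assumes \<mu>: "\<mu> \<in> space (subprob_algebra E)" and K: "K \<in> E \<rightarrow>\<^sub>M subprob_algebra E"
    and f: "f \<in> bounded_nonneg E"
  shows "(\<integral>y. f y \<partial>(\<mu> \<bind> K)) = (\<integral>y. \<integral>z. f z \<partial>K y \<partial>\<mu>)"
proof -
  have fm: "f \<in> borel_measurable E" using f by (simp add: bounded_nonneg_def)
  have s: "sets \<mu> = sets E" using \<mu> by (simp add: space_subprob_algebra)
  have K': "K \<in> \<mu> \<rightarrow>\<^sub>M subprob_algebra E" using K by (simp add: measurable_cong_sets[OF s refl])
  have "\<mu> \<bind> K \<in> space (subprob_algebra E)"
    using measurable_space[OF measurable_bind2[OF measurable_ident_sets[OF refl] K] \<mu>] by simp
  then have sb: "sets (\<mu> \<bind> K) = sets E" by (simp add: space_subprob_algebra)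
  have "(\<integral>\<^sup>+y. ennreal (f y) \<partial>(\<mu> \<bind> K)) = (\<integral>\<^sup>+y. \<integral>\<^sup>+z. ennreal (f z) \<partial>K y \<partial>\<mu>)"
    using fm by (intro nn_integral_bind[OF _ K']) measurable
  also have "\<dots> = (\<integral>\<^sup>+y. ennreal (\<integral>z. f z \<partial>K y) \<partial>\<mu>)"
    using f measurable_space[OF K'] by (intro nn_integral_cong nn_integral_bounded_nonneg)
  also have "\<dots> = ennreal (\<integral>y. \<integral>z. f z \<partial>K y \<partial>\<mu>)"
    by (rule nn_integral_bounded_nonneg(1)[OF kernel_integral_bounded_nonneg[OF K f] \<mu>])
  finally show ?thesis
    using integral_bounded_nonneg(2)[OF kernel_integral_bounded_nonneg[OF K f] s]
    by (simp add: integral_bounded_nonneg(1)[OF f sb])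
qed

text \<open>The mean kernel acting on functions; as operators, its powers are plain iterates
  \<open>^^\<close>.\<close>

definition LF_mean_op :: "('a \<Rightarrow> 'a measure) \<Rightarrow> 'a measure \<Rightarrow> real \<Rightarrow> ('a \<Rightarrow> real) \<Rightarrow> 'a \<Rightarrow> real" where
  "LF_mean_op K \<gamma> m f x = (\<integral>y. f y \<partial>K x) + measure (K x) (space (K x)) * m * (\<integral>y. f y \<partial>\<gamma>)"

lemma bounded_nonneg_const: "0 \<le> c \<Longrightarrow> (\<lambda>_. c) \<in> bounded_nonneg E"
  by (auto simp: bounded_nonneg_def)

lemma bounded_nonneg_add:
  "f \<in> bounded_nonneg E \<Longrightarrow> g \<in> bounded_nonneg E \<Longrightarrow> (\<lambda>x. f x + g x) \<in> bounded_nonneg E"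
  by (auto simp: bounded_nonneg_def Pi_iff) (meson add_mono)

lemma bounded_nonneg_scale:
  "0 \<le> c \<Longrightarrow> f \<in> bounded_nonneg E \<Longrightarrow> (\<lambda>x. f x * c) \<in> bounded_nonneg E"
  by (auto simp: bounded_nonneg_def Pi_iff) (meson mult_right_mono)

lemma kernel_mass_bounded_nonneg:
  assumes "K \<in> E \<rightarrow>\<^sub>M subprob_algebra E"
  shows "(\<lambda>y. measure (K y) (space (K y))) \<in> bounded_nonneg E"
  using kernel_integral_bounded_nonneg[OF assms bounded_nonneg_const[of 1]] by simp

lemma LF_mean_op_bounded_nonneg:
  assumes T: "LF_triplet E K \<gamma> m" and f: "f \<in> bounded_nonneg E"
  shows "LF_mean_op K \<gamma> m f \<in> bounded_nonneg E"
  unfolding LF_mean_op_def[abs_def] mult.assoc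
  using LF_tripletD(5)[OF T] integral_bounded_nonneg(2)[OF f LF_tripletD(3)[OF T]]
  by (intro bounded_nonneg_add bounded_nonneg_scale kernel_integral_bounded_nonneg
        kernel_mass_bounded_nonneg LF_tripletD(1)[OF T] f) simp

lemma funpow_LF_mean_op_bounded_nonneg:
  assumes "LF_triplet E K \<gamma> m" "f \<in> bounded_nonneg E"
  shows "(LF_mean_op K \<gamma> m ^^ n) f \<in> bounded_nonneg E"
  by (induction n) (auto simp: assms LF_mean_op_bounded_nonneg)

text \<open>\<open>LF_mean\<close> applies \<open>measure_of\<close> to a bare set function;
  recognising that function as an existing measure supplies countable additivity.\<close>

lemma LF_mean_eq_add_measure:
  assumes T: "LF_triplet E K \<gamma> m" and x: "x \<in> space E"
  shows "LF_mean E K \<gamma> m x = add_measure 1 (K x) (measure (K x) (space (K x)) * m) \<gamma>"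
    (is "_ = ?\<rho>")
proof -
  note * = LF_triplet_in_subprob_algebra(3)[OF T x] LF_triplet_in_subprob_algebra(1)[OF T]
  have "LF_mean E K \<gamma> m x = measure_of (space E) (sets E) (emeasure ?\<rho>)"
    unfolding LF_mean_def
    by (rule measure_of_eq[OF sets.space_closed])
       (simp add: LF_offspring_mean[OF T x] emeasure_add_measure[OF *] sets.sigma_sets_eq)
  then show ?thesis
    using measure_of_of_measure[of ?\<rho>] by (simp add: sets_add_measure[OF *] space_add_measure[OF *])
qed

lemma kernel_power_LF_mean:
  assumes T: "LF_triplet E K \<gamma> m" and x: "x \<in> space E" and A: "A \<in> sets E"
  shows "kernel_power (LF_mean E K \<gamma> m) n x A = (LF_mean_op K \<gamma> m ^^ n) (indicator A) x"
  using x
proof (induction n arbitrary: x)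
  case (Suc n)
  note * = LF_triplet_in_subprob_algebra(3)[OF T Suc.prems] LF_triplet_in_subprob_algebra(1)[OF T]
  let ?f = "(LF_mean_op K \<gamma> m ^^ n) (indicator A)"
  have "indicator A \<in> bounded_nonneg E"
    using A by (auto simp: bounded_nonneg_def Pi_iff intro!: exI[of _ 1])
  then have f: "?f \<in> bounded_nonneg E" by (rule funpow_LF_mean_op_bounded_nonneg[OF T])
  have "kernel_power (LF_mean E K \<gamma> m) (Suc n) x A = (\<integral>y. ?f y \<partial>LF_mean E K \<gamma> m x)"
    unfolding kernel_power.simps LF_mean_eq_add_measure[OF T Suc.prems]
    by (rule Bochner_Integration.integral_cong) (auto simp: space_add_measure[OF *] Suc.IH)
  also have "\<dots> = LF_mean_op K \<gamma> m ?f x"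
    unfolding LF_mean_eq_add_measure[OF T Suc.prems]
    using LF_tripletD(5)[OF T] by (subst integral_add_measure[OF * _ _ f]) (auto simp: LF_mean_op_def)
  finally show ?case by simp
qed simp

section \<open>Composition of linear-fractional functionals\<close>

text \<open>The inner functional enters only through its integrals over \<open>K1 x\<close> and
  \<open>\<gamma>1\<close>, which share one denominator, and this cancels. Under iteration the first
  identity produces the sum over \<open>k\<close>, the second the powers of the mean kernel.\<close>

lemma LF_triplet_compose:
  assumes T1: "LF_triplet E K1 \<gamma>1 m1" and T2: "LF_triplet E K2 \<gamma>2 m2"
  obtains K \<gamma> m where "LF_triplet E K \<gamma> m"
    and "\<And>f. f \<in> bounded_nonneg E \<Longrightarrow>
      m * (\<integral>y. f y \<partial>\<gamma>) = m2 * (\<integral>y. f y \<partial>\<gamma>2) + m1 * (\<integral>y. LF_mean_op K2 \<gamma>2 m2 f y \<partial>\<gamma>1)"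
    and "\<And>f x. f \<in> bounded_nonneg E \<Longrightarrow> x \<in> space E \<Longrightarrow>
      LF_mean_op K \<gamma> m f x = LF_mean_op K1 \<gamma>1 m1 (LF_mean_op K2 \<gamma>2 m2 f) x"
    and "\<And>h x. h \<in> unit_function E \<Longrightarrow> x \<in> space E \<Longrightarrow>
      LF_gf K \<gamma> m h x = LF_gf K1 \<gamma>1 m1 (LF_gf K2 \<gamma>2 m2 h) x"
proof -
  note [measurable] = LF_tripletD(1)[OF T1] LF_tripletD(1)[OF T2]
  have m1: "0 < m1" and m2: "0 < m2" using LF_tripletD(5)[OF T1] LF_tripletD(5)[OF T2] .
  note \<gamma>1 = LF_triplet_in_subprob_algebra(1)[OF T1] and \<gamma>2 = LF_triplet_in_subprob_algebra(1)[OF T2]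
  note K1 = LF_triplet_in_subprob_algebra(3)[OF T1] and K2 = LF_tripletD(1)[OF T2]
  interpret \<gamma>1: prob_space \<gamma>1 by (rule LF_tripletD[OF T1])
  interpret \<gamma>2: prob_space \<gamma>2 by (rule LF_tripletD[OF T2])
  text \<open>With \<open>D = 1 + m2 - m2 \<integral> h d\<gamma>2\<close>, the outer denominator is \<open>(s D - m1 \<integral> J h d\<gamma>1) / D\<close>, which
    dictates \<open>m\<close> and \<open>\<gamma>\<close>. Substituting \<open>D = (s D - m1 \<integral> J h d\<gamma>1 + m1 \<integral> J h d\<gamma>1) / s\<close> in the
    numerator \<open>(p1 - q) D + \<integral> J h dK1\<close> makes all coefficients of \<open>K\<close> nonnegative.\<close>
  define J where "J f y = (\<integral>z. f z \<partial>K2 y)" for f :: "'a \<Rightarrow> real" and y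
  define p1 where "p1 x = measure (K1 x) (space (K1 x))" for x
  define p2 where "p2 y = measure (K2 y) (space (K2 y))" for y
  \<comment> \<open>\<open>a\<close> is the mass of \<open>\<nu>\<close>, and \<open>s\<close> is
    the coefficient of \<open>D\<close> once the outer denominator is multiplied by
    \<open>D\<close>.\<close>
  define a where "a = (\<integral>y. p2 y \<partial>\<gamma>1)"
  define s where "s = 1 + m1 * a"
  define q where "q x = (\<integral>y. p2 y \<partial>K1 x)" for x
  \<comment> \<open>The total mass of \<open>s * m2 * \<gamma>2 + m1 * \<nu>\<close>, so that
    dividing by it makes \<open>\<gamma>\<close> a probability measure.\<close>
  define m where "m = s * m2 + m1 * a"
  define \<nu> where "\<nu> = \<gamma>1 \<bind> K2"
  define \<gamma> where "\<gamma> = add_measure (s * m2 / m) \<gamma>2 (m1 / m) \<nu>"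
  define K where "K x = add_measure 1 (K1 x \<bind> K2) ((p1 x - q x) * m1 / s) \<nu>" for x
  have J_bn: "J f \<in> bounded_nonneg E" if "f \<in> bounded_nonneg E" for f
    unfolding J_def[abs_def] by (rule kernel_integral_bounded_nonneg[OF K2 that])
  have p2_bn: "p2 \<in> bounded_nonneg E"
    unfolding p2_def[abs_def] by (rule kernel_mass_bounded_nonneg[OF K2])
  have J_1: "J (\<lambda>_. 1) = p2" by (simp add: J_def[abs_def] p2_def[abs_def])
  have p2_unit: "p2 \<in> unit_function E"
    using p2_bn subprob_space.subprob_measure_le_1[OF LF_tripletD(8)[OF T2]]
    by (auto simp: unit_function_def bounded_nonneg_def p2_def)
  have a: "0 \<le> a" using integral_bounded_nonneg(2)[OF p2_bn LF_tripletD(3)[OF T1]] by (simp add: a_def)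
  then have s: "1 \<le> s" using m1 by (simp add: s_def)
  have "0 < s * m2" using s m2 by simp
  then have m: "0 < m" using a m1 by (simp add: m_def add_pos_nonneg)
  have q: "0 \<le> q x" "q x \<le> p1 x" "p1 x \<le> 1" if "x \<in> space E" for x
    using integral_bounded_nonneg(2)[OF p2_bn LF_tripletD(6)[OF T1 that]]
      integral_unit_function_le[OF p2_unit K1[OF that]]
      subprob_space.subprob_measure_le_1[OF LF_tripletD(8)[OF T1 that]]
    by (simp_all add: q_def p1_def)
  have bind: "\<mu> \<bind> K2 \<in> space (subprob_algebra E)" if "\<mu> \<in> space (subprob_algebra E)" for \<mu>
    using measurable_space[OF measurable_bind2[OF measurable_ident_sets[OF refl] K2] that] by simp
  have \<nu>: "\<nu> \<in> space (subprob_algebra E)" unfolding \<nu>_def by (rule bind[OF \<gamma>1])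
  have \<nu>_int: "(\<integral>y. f y \<partial>\<nu>) = (\<integral>y. J f y \<partial>\<gamma>1)" if "f \<in> bounded_nonneg E" for f
    unfolding \<nu>_def J_def by (rule integral_bind_bounded_nonneg[OF \<gamma>1 K2 that])
  have \<gamma>_int: "m * (\<integral>y. f y \<partial>\<gamma>) = s * m2 * (\<integral>y. f y \<partial>\<gamma>2) + m1 * (\<integral>y. J f y \<partial>\<gamma>1)"
    if f: "f \<in> bounded_nonneg E" for f
    unfolding \<gamma>_def using s m m1 m2
    by (subst integral_add_measure[OF \<gamma>2 \<nu> _ _ f]) (auto simp: \<nu>_int[OF f] field_simps)
  have K_int: "(\<integral>y. f y \<partial>K x) = (\<integral>y. J f y \<partial>K1 x) + (p1 x - q x) * m1 / s * (\<integral>y. J f y \<partial>\<gamma>1)"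
    if f: "f \<in> bounded_nonneg E" and x: "x \<in> space E" for f x
    unfolding K_def using s m1 q[OF x] integral_bind_bounded_nonneg[OF K1[OF x] K2 f]
    by (subst integral_add_measure[OF bind[OF K1[OF x]] \<nu> _ _ f]) (auto simp: \<nu>_int[OF f] J_def[abs_def])
  have one: "(\<lambda>_. 1) \<in> bounded_nonneg E" by (rule bounded_nonneg_const) simp
  \<comment> \<open>By \<open>m1 * a = s - 1\<close>, this mass is a convex combination of
    \<open>p1 x\<close> and \<open>q x\<close>, hence at most 1.\<close>
  have K_mass: "measure (K x) (space (K x)) = p1 x - (p1 x - q x) / s" if "x \<in> space E" for x
  proof -
    have "measure (K x) (space (K x)) = q x + (p1 x - q x) * m1 / s * a"
      using K_int[OF one that] by (simp add: J_1 q_def a_def)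
    also have "\<dots> = q x + (p1 x - q x) * (s - 1) / s" by (simp add: s_def)
    also have "\<dots> = p1 x - (p1 x - q x) / s" using s by (simp add: field_simps)
    finally show ?thesis .
  qed
  have T: "LF_triplet E K \<gamma> m"
    unfolding LF_triplet_def
  proof (intro conjI m)
    show s\<gamma>: "sets \<gamma> = sets E" unfolding \<gamma>_def by (rule sets_add_measure[OF \<gamma>2 \<nu>])
    have "m * measure \<gamma> (space \<gamma>) = m"
      using \<gamma>_int[OF one] by (simp add: J_1 a_def[symmetric] m_def \<gamma>2.prob_space)
    then have "measure \<gamma> (space \<gamma>) = 1" using m by simp
    \<comment> \<open>Real measure 1 excludes infinite mass, as \<open>enn2real\<close> sends
      \<open>\<infinity>\<close> to 0.\<close>
    then show "prob_space \<gamma>"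
      by (intro prob_spaceI) (simp add: measure_def)
    show "K \<in> E \<rightarrow>\<^sub>M subprob_algebra E"
    proof (rule measurable_subprob_algebra)
      fix x assume x: "x \<in> space E"
      note \<mu> = bind[OF K1[OF x]]
      show sK: "sets (K x) = sets E" unfolding K_def by (rule sets_add_measure[OF \<mu> \<nu>])
      \<comment> \<open>Finiteness comes before \<open>K_mass\<close> is used, since a real mass of
        0 could hide an infinite one.\<close>
      have "emeasure (K x) (space E) \<noteq> \<infinity>"
      proof -
        interpret B: subprob_space "K1 x \<bind> K2" using \<mu> by (simp add: space_subprob_algebra)
        interpret \<nu>: subprob_space \<nu> using \<nu> by (simp add: space_subprob_algebra)
        show ?thesis
          unfolding K_def by (subst emeasure_add_measure[OF \<mu> \<nu>])
            (auto simp: B.emeasure_eq_measure \<nu>.emeasure_eq_measure ennreal_mult_eq_top_iff)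
      qed
      then interpret finite_measure "K x"
        using sets_eq_imp_space_eq[OF sK] by (intro finite_measureI) simp
      have "0 \<le> (p1 x - q x) / s" using q[OF x] s by simp
      then have "p1 x - (p1 x - q x) / s \<le> 1" using q(3)[OF x] by linarith
      then show "subprob_space (K x)"
        using x sets_eq_imp_space_eq[OF sK] K_mass[OF x]
        by (intro subprob_spaceI) (auto simp: emeasure_eq_measure)
    next
      fix A assume A [measurable]: "A \<in> sets E"
      have [measurable]: "(\<lambda>x. K1 x \<bind> K2) \<in> E \<rightarrow>\<^sub>M subprob_algebra E"
        by (rule measurable_bind2[OF _ K2]) measurable
      have [measurable]: "p1 \<in> borel_measurable E" "q \<in> borel_measurable E"
        using kernel_mass_bounded_nonneg[OF LF_tripletD(1)[OF T1]]
          kernel_integral_bounded_nonneg[OF LF_tripletD(1)[OF T1] p2_bn]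
        by (simp_all add: p1_def[abs_def] q_def[abs_def] bounded_nonneg_def)
      have "(\<lambda>x. emeasure (K1 x \<bind> K2) A + ennreal ((p1 x - q x) * m1 / s) * emeasure \<nu> A)
          \<in> borel_measurable E"
        by measurable
      then show "(\<lambda>x. emeasure (K x) A) \<in> borel_measurable E"
        by (rule measurable_cong[THEN iffD1, rotated])
           (simp add: K_def emeasure_add_measure[OF bind[OF K1] \<nu> A])
    qed
  qed
  have M_int: "(\<integral>y. LF_mean_op K2 \<gamma>2 m2 f y \<partial>\<mu>) =
      (\<integral>y. J f y \<partial>\<mu>) + (\<integral>y. p2 y \<partial>\<mu>) * m2 * (\<integral>y. f y \<partial>\<gamma>2)"
    if f: "f \<in> bounded_nonneg E" and \<mu>: "\<mu> \<in> space (subprob_algebra E)" for f \<mu>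
    unfolding LF_mean_op_def J_def[symmetric] p2_def[symmetric]
    using nn_integral_bounded_nonneg(2)[OF p2_bn \<mu>] nn_integral_bounded_nonneg(2)[OF J_bn[OF f] \<mu>]
    by simp
  show thesis
  proof (rule that[OF T])
    fix f assume f: "f \<in> bounded_nonneg E"
    show "m * (\<integral>y. f y \<partial>\<gamma>) = m2 * (\<integral>y. f y \<partial>\<gamma>2) + m1 * (\<integral>y. LF_mean_op K2 \<gamma>2 m2 f y \<partial>\<gamma>1)"
      unfolding \<gamma>_int[OF f] M_int[OF f \<gamma>1] by (simp add: s_def a_def algebra_simps)
  next
    fix f x assume f: "f \<in> bounded_nonneg E" and x: "x \<in> space E"
    define X Y g where "X = (\<integral>y. J f y \<partial>K1 x)" and "Y = (\<integral>y. J f y \<partial>\<gamma>1)" and "g = (\<integral>y. f y \<partial>\<gamma>2)"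
    \<comment> \<open>The \<open>\<nu>\<close>-part of \<open>K x\<close> cancels against the amount
      by which the mass of \<open>K x\<close> falls short of \<open>p1 x\<close>, multiplied by
      \<open>m1 * Y\<close>.\<close>
    have "LF_mean_op K \<gamma> m f x =
        X + (p1 x - q x) * m1 / s * Y + (p1 x - (p1 x - q x) / s) * (s * m2 * g + m1 * Y)"
      unfolding LF_mean_op_def K_mass[OF x] K_int[OF f x] mult.assoc \<gamma>_int[OF f]
      by (simp add: X_def Y_def g_def)
    also have "\<dots> = X + q x * m2 * g + p1 x * m1 * Y + p1 x * (s - 1) * m2 * g"
      using s by (simp add: field_simps)
    also have "\<dots> = X + q x * m2 * g + p1 x * m1 * (Y + a * m2 * g)"
      by (simp add: s_def algebra_simps)
    also have "\<dots> = LF_mean_op K1 \<gamma>1 m1 (LF_mean_op K2 \<gamma>2 m2 f) x"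
      unfolding LF_mean_op_def[of K1] M_int[OF f K1[OF x]] M_int[OF f \<gamma>1]
      by (simp add: p1_def q_def a_def X_def Y_def g_def)
    finally show "LF_mean_op K \<gamma> m f x = LF_mean_op K1 \<gamma>1 m1 (LF_mean_op K2 \<gamma>2 m2 f) x" .
  next
    fix h x assume h: "h \<in> unit_function E" and x: "x \<in> space E"
    note h' = unit_function_bounded_nonneg[OF h]
    define X Y g D where "X = (\<integral>y. J h y \<partial>K1 x)" and "Y = (\<integral>y. J h y \<partial>\<gamma>1)"
      and "g = (\<integral>y. h y \<partial>\<gamma>2)" and "D = 1 + m2 - m2 * g"
    have D: "1 \<le> D" using LF_denominator_ge_1[OF T2 h] by (simp add: D_def g_def)
    have gf_int: "(\<integral>y. LF_gf K2 \<gamma>2 m2 h y \<partial>\<mu>) =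
        measure \<mu> (space \<mu>) - (\<integral>y. p2 y \<partial>\<mu>) + (\<integral>y. J h y \<partial>\<mu>) / D"
      if \<mu>: "\<mu> \<in> space (subprob_algebra E)" for \<mu>
    proof -
      interpret subprob_space \<mu> using \<mu> by (simp add: space_subprob_algebra)
      show ?thesis
        unfolding LF_gf_def J_def[symmetric] p2_def[symmetric] g_def[symmetric] D_def[symmetric]
        using nn_integral_bounded_nonneg(2)[OF p2_bn \<mu>] nn_integral_bounded_nonneg(2)[OF J_bn[OF h'] \<mu>]
        by simp
    qed
    have "1 + m - m * (\<integral>y. h y \<partial>\<gamma>) = s * D - m1 * Y"
      unfolding \<gamma>_int[OF h'] by (simp add: m_def D_def g_def Y_def s_def algebra_simps)
    \<comment> \<open>The bound is the general denominator bound for the composed triplet, already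
      known to be one.\<close>
    moreover from this have pos: "s * D - m1 * Y \<ge> 1"
      using LF_denominator_ge_1[OF T h] by simp
    ultimately have "LF_gf K \<gamma> m h x =
        1 - (p1 x - (p1 x - q x) / s) + (X + (p1 x - q x) * m1 / s * Y) / (s * D - m1 * Y)"
      unfolding LF_gf_def K_mass[OF x] K_int[OF h' x] by (simp add: X_def Y_def)
    also have "\<dots> = 1 - p1 x + (X + (p1 x - q x) * D) / (s * D - m1 * Y)"
    proof -
      \<comment> \<open>Over the common denominator the \<open>Y\<close> terms of the numerator
        cancel, and only \<open>(p1 x - q x) * D\<close> is added to \<open>X\<close>.\<close>
      have "(p1 x - q x) / s = (p1 x - q x) / s * (s * D - m1 * Y) / (s * D - m1 * Y)"
        using pos by simp
      also have "(p1 x - q x) / s * (s * D - m1 * Y) = (p1 x - q x) * D - (p1 x - q x) * m1 / s * Y"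
        using s by (simp add: field_simps)
      finally show ?thesis by (simp add: add_divide_distrib diff_divide_distrib)
    qed
    \<comment> \<open>Dividing by \<open>D\<close> brings out \<open>p1 x - q x + X / D\<close> and
      \<open>1 - a + Y / D\<close>, the integrals of the inner functional over \<open>K1 x\<close>
      and \<open>\<gamma>1\<close>.\<close>
    also have "\<dots> = 1 - p1 x + (p1 x - q x + X / D) / (1 + m1 - m1 * (1 - a + Y / D))"
    proof -
      have "1 + m1 - m1 * (1 - a + Y / D) = (s * D - m1 * Y) / D"
        using D by (simp add: s_def field_simps)
      moreover have "p1 x - q x + X / D = (X + (p1 x - q x) * D) / D"
        using D by (simp add: field_simps)
      ultimately show ?thesis using D by simp
    qed
    also have "\<dots> = LF_gf K1 \<gamma>1 m1 (LF_gf K2 \<gamma>2 m2 h) x"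
      unfolding LF_gf_def[of K1] gf_int[OF K1[OF x]] gf_int[OF \<gamma>1]
      by (simp add: p1_def q_def a_def X_def Y_def \<gamma>1.prob_space)
    finally show "LF_gf K \<gamma> m h x = LF_gf K1 \<gamma>1 m1 (LF_gf K2 \<gamma>2 m2 h) x" .
  qed
qed

text \<open>Exponents start at 1: for exponent 0 the empty sum would give \<open>mn = 0\<close>. In
  each composition the previous iterate is outside and the base triplet inside.\<close>

lemma LF_triplet_iterate:
  assumes T: "LF_triplet E K \<gamma> m"
  obtains Kn \<gamma>n mn where "LF_triplet E Kn \<gamma>n mn"
    and "\<And>f. f \<in> bounded_nonneg E \<Longrightarrow>
      mn * (\<integral>y. f y \<partial>\<gamma>n) = m * (\<Sum>k<Suc n. \<integral>y. (LF_mean_op K \<gamma> m ^^ k) f y \<partial>\<gamma>)"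
    and "\<And>f x. f \<in> bounded_nonneg E \<Longrightarrow> x \<in> space E \<Longrightarrow>
      LF_mean_op Kn \<gamma>n mn f x = (LF_mean_op K \<gamma> m ^^ Suc n) f x"
    and "\<And>h x. h \<in> unit_function E \<Longrightarrow> x \<in> space E \<Longrightarrow>
      LF_gf Kn \<gamma>n mn h x = (LF_gf K \<gamma> m ^^ Suc n) h x"
proof (induction n arbitrary: thesis)
  case 0
  from 0[OF T] show ?case by simp
next
  case (Suc n)
  obtain Kn \<gamma>n mn where n: "LF_triplet E Kn \<gamma>n mn"
    "\<And>f. f \<in> bounded_nonneg E \<Longrightarrow>
      mn * (\<integral>y. f y \<partial>\<gamma>n) = m * (\<Sum>k<Suc n. \<integral>y. (LF_mean_op K \<gamma> m ^^ k) f y \<partial>\<gamma>)"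
    "\<And>f x. f \<in> bounded_nonneg E \<Longrightarrow> x \<in> space E \<Longrightarrow>
      LF_mean_op Kn \<gamma>n mn f x = (LF_mean_op K \<gamma> m ^^ Suc n) f x"
    "\<And>h x. h \<in> unit_function E \<Longrightarrow> x \<in> space E \<Longrightarrow>
      LF_gf Kn \<gamma>n mn h x = (LF_gf K \<gamma> m ^^ Suc n) h x"
    using Suc.IH by blast
  obtain K' \<gamma>' m' where c: "LF_triplet E K' \<gamma>' m'"
    "\<And>f. f \<in> bounded_nonneg E \<Longrightarrow>
      m' * (\<integral>y. f y \<partial>\<gamma>') = m * (\<integral>y. f y \<partial>\<gamma>) + mn * (\<integral>y. LF_mean_op K \<gamma> m f y \<partial>\<gamma>n)"
    "\<And>f x. f \<in> bounded_nonneg E \<Longrightarrow> x \<in> space E \<Longrightarrow>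
      LF_mean_op K' \<gamma>' m' f x = LF_mean_op Kn \<gamma>n mn (LF_mean_op K \<gamma> m f) x"
    "\<And>h x. h \<in> unit_function E \<Longrightarrow> x \<in> space E \<Longrightarrow>
      LF_gf K' \<gamma>' m' h x = LF_gf Kn \<gamma>n mn (LF_gf K \<gamma> m h) x"
    using LF_triplet_compose[OF n(1) T] by blast
  note b = LF_mean_op_bounded_nonneg[OF T] and u = LF_gf_unit_function[OF T]
  show ?case
  proof (rule Suc.prems[OF c(1)])
    fix f assume f: "f \<in> bounded_nonneg E"
    \<comment> \<open>The previous iterate, evaluated at \<open>LF_mean_op K \<gamma> m f\<close>,
      contributes the powers 1 to \<open>Suc n\<close>, and the base triplet the power 0; hence the
      shifted sum.\<close>
    show "m' * (\<integral>y. f y \<partial>\<gamma>') = m * (\<Sum>k<Suc (Suc n). \<integral>y. (LF_mean_op K \<gamma> m ^^ k) f y \<partial>\<gamma>)"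
      unfolding c(2)[OF f] n(2)[OF b[OF f]]
      by (subst (2) sum.lessThan_Suc_shift) (simp add: funpow_swap1 distrib_left del: sum.lessThan_Suc)
  qed (simp_all add: c n b u funpow_swap1)
qed

section \<open>The triplet of generation n and its uniqueness\<close>

theorem theorem2:
  fixes E :: "'a measure" and K :: "'a \<Rightarrow> 'a measure" and \<gamma> :: "'a measure" and m :: real
  assumes "LF_triplet E K \<gamma> m"
  shows
    "(\<forall>x \<in> space E. \<forall>(\<Omega> :: 'w measure) Z. LF_process E K \<gamma> m x \<Omega> Z \<longrightarrow>
        (\<forall>h \<in> E \<rightarrow>\<^sub>M borel. h \<in> space E \<rightarrow> {0..1} \<longrightarrow>
           (\<integral>\<omega>. (\<Prod>y\<leftarrow>Z 1 \<omega>. h y) \<partial>\<Omega>) = LF_gf K \<gamma> m h x)) \<and>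
     (\<forall>n\<ge>2. \<exists>Kn \<gamma>n mn.
        LF_triplet E Kn \<gamma>n mn \<and> LF_iterate_relations E K \<gamma> m n Kn \<gamma>n mn \<and>
        (\<forall>Kn' \<gamma>n' mn'.
           LF_triplet E Kn' \<gamma>n' mn' \<and> LF_iterate_relations E K \<gamma> m n Kn' \<gamma>n' mn' \<longrightarrow>
           (\<forall>x \<in> space E. Kn' x = Kn x) \<and> \<gamma>n' = \<gamma>n \<and> mn' = mn) \<and>
        (\<forall>x \<in> space E. \<forall>(\<Omega> :: 'w measure) Z. LF_process E K \<gamma> m x \<Omega> Z \<longrightarrow>
           (\<forall>h \<in> E \<rightarrow>\<^sub>M borel. h \<in> space E \<rightarrow> {0..1} \<longrightarrow>
              (\<integral>\<omega>. (\<Prod>y\<leftarrow>Z n \<omega>. h y) \<partial>\<Omega>) = LF_gf Kn \<gamma>n mn h x)))"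
proof (intro conjI allI impI ballI)
  note T = assms
  show "(\<integral>\<omega>. (\<Prod>y\<leftarrow>Z 1 \<omega>. h y) \<partial>\<Omega>) = LF_gf K \<gamma> m h x"
    if "x \<in> space E" "LF_process E K \<gamma> m x \<Omega> Z" "h \<in> borel_measurable E" "h \<in> space E \<rightarrow> {0..1}"
    for x h and \<Omega> :: "'w measure" and Z
    using LF_process_gf[OF T that(1,2), of h 1] that(3,4) by (simp add: unit_function_def)
  fix n :: nat assume "2 \<le> n"
  then obtain n' where n: "n = Suc n'" by (cases n) auto
  obtain Kn \<gamma>n mn where Tn: "LF_triplet E Kn \<gamma>n mn"
    and \<gamma>n: "\<And>f. f \<in> bounded_nonneg E \<Longrightarrow>
      mn * (\<integral>y. f y \<partial>\<gamma>n) = m * (\<Sum>k<n. \<integral>y. (LF_mean_op K \<gamma> m ^^ k) f y \<partial>\<gamma>)"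
    and Mn: "\<And>f x. f \<in> bounded_nonneg E \<Longrightarrow> x \<in> space E \<Longrightarrow>
      LF_mean_op Kn \<gamma>n mn f x = (LF_mean_op K \<gamma> m ^^ n) f x"
    and gfn: "\<And>h x. h \<in> unit_function E \<Longrightarrow> x \<in> space E \<Longrightarrow>
      LF_gf Kn \<gamma>n mn h x = (LF_gf K \<gamma> m ^^ n) h x"
    unfolding n using LF_triplet_iterate[OF T] by blast
  interpret \<gamma>n: prob_space \<gamma>n by (rule LF_tripletD[OF Tn])
  let ?M = "kernel_power (LF_mean E K \<gamma> m)"
  have ind: "indicator A \<in> bounded_nonneg E" if "A \<in> sets E" for A :: "'a set"
    using that by (auto simp: bounded_nonneg_def Pi_iff intro!: exI[of _ 1])
  have \<gamma>nA: "mn * measure \<gamma>n A = m * (\<Sum>k<n. \<integral>x. ?M k x A \<partial>\<gamma>)" if A: "A \<in> sets E" for A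
  proof -
    have "(\<integral>x. (LF_mean_op K \<gamma> m ^^ k) (indicator A) x \<partial>\<gamma>) = (\<integral>x. ?M k x A \<partial>\<gamma>)" for k
      by (rule Bochner_Integration.integral_cong) (simp_all add: kernel_power_LF_mean[OF T _ A] LF_tripletD(4)[OF T])
    with \<gamma>n[OF ind[OF A]] A show ?thesis by (simp add: LF_tripletD(3)[OF Tn])
  qed
  \<comment> \<open>The case \<open>A = space E\<close>, where \<open>\<gamma>n\<close> has mass
    1.\<close>
  have mn: "mn = m * (\<Sum>k<n. \<integral>x. ?M k x (space E) \<partial>\<gamma>)" "0 < mn"
    using \<gamma>nA[of "space E"] \<gamma>n.prob_space LF_tripletD(4,5)[OF Tn] by simp_all
  have MnA: "?M n x A = measure (Kn x) A + measure (Kn x) (space E) * mn * measure \<gamma>n A"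
    if x: "x \<in> space E" and A: "A \<in> sets E" for x A
    using Mn[OF ind[OF A] x] A
    by (simp add: kernel_power_LF_mean[OF T x A] LF_mean_op_def LF_tripletD(3,6,7)[OF Tn] x)
  have R: "LF_iterate_relations E K \<gamma> m n Kn \<gamma>n mn"
    unfolding LF_iterate_relations_def Let_def
  proof (intro conjI ballI mn(1))
    show "measure \<gamma>n A = inverse mn * m * (\<Sum>k<n. \<integral>x. ?M k x A \<partial>\<gamma>)" if "A \<in> sets E" for A
      using mn(2) unfolding mult.assoc \<gamma>nA[OF that, symmetric] by simp
    fix x A assume x: "x \<in> space E" and A: "A \<in> sets E"
    \<comment> \<open>Expresses the mass of \<open>Kn x\<close> through the mean kernel, so that it
      can be eliminated from \<open>MnA\<close>.\<close>
    have "?M n x (space E) = measure (Kn x) (space E) * (1 + mn)"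
      using MnA[OF x sets.top] \<gamma>n.prob_space by (simp add: LF_tripletD(4)[OF Tn] algebra_simps)
    then show "measure (Kn x) A = ?M n x A - mn / (1 + mn) * ?M n x (space E) * measure \<gamma>n A"
      using mn(2) by (simp add: MnA[OF x A])
  qed
  show "\<exists>Kn \<gamma>n mn. LF_triplet E Kn \<gamma>n mn \<and> LF_iterate_relations E K \<gamma> m n Kn \<gamma>n mn \<and>
        (\<forall>Kn' \<gamma>n' mn'.
           LF_triplet E Kn' \<gamma>n' mn' \<and> LF_iterate_relations E K \<gamma> m n Kn' \<gamma>n' mn' \<longrightarrow>
           (\<forall>x \<in> space E. Kn' x = Kn x) \<and> \<gamma>n' = \<gamma>n \<and> mn' = mn) \<and>
        (\<forall>x \<in> space E. \<forall>(\<Omega> :: 'w measure) Z. LF_process E K \<gamma> m x \<Omega> Z \<longrightarrow>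
           (\<forall>h \<in> E \<rightarrow>\<^sub>M borel. h \<in> space E \<rightarrow> {0..1} \<longrightarrow>
              (\<integral>\<omega>. (\<Prod>y\<leftarrow>Z n \<omega>. h y) \<partial>\<Omega>) = LF_gf Kn \<gamma>n mn h x))"
  proof (intro exI conjI allI impI ballI, rule Tn, rule R)
    fix Kn' \<gamma>n' mn' assume "LF_triplet E Kn' \<gamma>n' mn' \<and> LF_iterate_relations E K \<gamma> m n Kn' \<gamma>n' mn'"
    then have T': "LF_triplet E Kn' \<gamma>n' mn'" and R': "LF_iterate_relations E K \<gamma> m n Kn' \<gamma>n' mn'" by auto
    \<comment> \<open>The relations are triangular: \<open>mn\<close> is determined by the original
      triplet, then \<open>\<gamma>n\<close> by \<open>mn\<close>, then \<open>Kn\<close> by both.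
      All measures are finite, so equal real values give equal measures.\<close>
    show mn': "mn' = mn" using R R' by (simp add: LF_iterate_relations_def Let_def)
    interpret \<gamma>n': prob_space \<gamma>n' by (rule LF_tripletD[OF T'])
    have \<gamma>n': "measure \<gamma>n' A = measure \<gamma>n A" if "A \<in> sets E" for A
      using R R' that mn' by (simp add: LF_iterate_relations_def Let_def)
    then show "\<gamma>n' = \<gamma>n"
      by (intro measure_eqI) (simp_all add: LF_tripletD(3)[OF T'] LF_tripletD(3)[OF Tn]
        \<gamma>n.emeasure_eq_measure \<gamma>n'.emeasure_eq_measure)
    fix x assume x: "x \<in> space E"
    interpret Kn: subprob_space "Kn x" using x by (rule LF_tripletD[OF Tn])
    interpret Kn': subprob_space "Kn' x" using x by (rule LF_tripletD[OF T'])
    have "measure (Kn' x) A = measure (Kn x) A" if "A \<in> sets E" for A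
      using R R' that mn' \<gamma>n' x by (simp add: LF_iterate_relations_def Let_def)
    then show "Kn' x = Kn x"
      by (intro measure_eqI) (simp_all add: LF_tripletD(6)[OF T' x] LF_tripletD(6)[OF Tn x]
        Kn.emeasure_eq_measure Kn'.emeasure_eq_measure)
  next
    fix x and h :: "'a \<Rightarrow> real" and \<Omega> :: "'w measure" and Z
    assume x: "x \<in> space E" and P: "LF_process E K \<gamma> m x \<Omega> Z"
      and "h \<in> borel_measurable E" "h \<in> space E \<rightarrow> {0..1}"
    then have h: "h \<in> unit_function E" by (simp add: unit_function_def)
    show "(\<integral>\<omega>. (\<Prod>y\<leftarrow>Z n \<omega>. h y) \<partial>\<Omega>) = LF_gf Kn \<gamma>n mn h x"
      using LF_process_gf[OF T x P h] gfn[OF h x] by simp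
  qed
qed

end
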